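(* Let $0<q<1$, $t_0>0$, $\epsilon(t)=\frac{1}{t^q}$, and let $x:[t_0,+\infty)\to\mathcal{H}$ be a solution trajectory (strong global solution) of $$\ddot{x}(t)+\frac{\delta}{t^{q/2}}\dot{x}(t)+\frac{1}{\gamma}t^{\frac q2}\frac{d}{dt}\Big(\mathcal{A}_{\eta}x(t)+\frac{1}{t^q}x(t)\Big)+\mathcal{A}_{\eta}x(t)+\frac{1}{t^q}x(t)=0 .$$ Assume that $\gamma<\delta<\gamma+\frac{\gamma}{\frac12\gamma^2+1}$. For $t\ge t_0$ let $x_{\epsilon(t)}$ denote the unique point with $\mathcal{A}_\eta x_{\epsilon(t)}+\epsilon(t)x_{\epsilon(t)}=0$. Then: (i) If $0<q<\frac23$, then as $t\to+\infty$, $$\|x(t)-x_{\epsilon(t)}\|^2=O\big(t^{\frac q2-1}\big),\quad \|\dot{x}(t)\|^2=O\big(t^{-\frac q2-1}\big),\quad \|\mathcal{A}_\eta x(t)+\epsilon(t)x_{\epsilon(t)}\|^2=O\big(t^{-\frac q2-1}\big).$$ (ii) If $\frac23\le q<1$, then as $t\to+\infty$, $$\|x(t)-x_{\epsilon(t)}\|^2=O\big(t^{2q-2}\big),\quad \|\dot{x}(t)\|^2=O\big(t^{q-2}\big),\quad \|\mathcal{A}_\eta x(t)+\epsilon(t)x_{\epsilon(t)}\|^2=O\big(t^{q-2}\big).$$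
   Context: $\mathcal{H}$ is a real Hilbert space. For $\mathcal{A}:\mathcal{H}\to2^{\mathcal{H}}$, $\operatorname{gra}\mathcal{A}=\{(x,u):u\in\mathcal{A}x\}$ and $\operatorname{zer}\mathcal{A}=\{x:0\in\mathcal{A}x\}$. For $\rho\in\mathbb{R}$, $\mathcal{A}$ is $\rho$-comonotone if $\langle x-y,u-v\rangle\ge\rho\|u-v\|^2$ for all $(x,u),(y,v)\in\operatorname{gra}\mathcal{A}$; it is maximally $\rho$-comonotone if moreover no $\rho$-comonotone operator has a graph properly containing $\operatorname{gra}\mathcal{A}$. For $\eta>0$, $J_\eta^{\mathcal{A}}=(Id+\eta\mathcal{A})^{-1}$ is the resolvent and $\mathcal{A}_\eta=\frac1\eta(Id-J_\eta^{\mathcal{A}})$ is the Yosida regularization. When $\mathcal{A}$ is maximally $\rho$-comonotone and $\eta>\max\{-2\rho,0\}$, both are single-valued and defined on all of $\mathcal{H}$, and $\mathcal{A}_\eta+\epsilon(t)Id$ has a unique zero for $\epsilon(t)>0$. Standing assumptions: $\mathcal{A}:\mathcal{H}\to2^{\mathcal{H}}$ is maximally $\rho$-comonotone with $\rho\in\mathbb{R}$ and $\operatorname{zer}\mathcal{A}\ne\emptyset$; $\eta>\max\{-2\rho,0\}$; $\delta>0$, $\gamma>0$. A strong global solution of the system is a function $x:[t_0,+\infty)\to\mathcal{H}$ such that $x$ and $\dot x$ are locally absolutely continuous (absolutely continuous on each $[t_0,T]$, $t_0<T<+\infty$) and the equation holds for almost every $t\ge t_0$. *)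

theory Defs
  imports "HOL-Analysis.Analysis" "HOL-Library.Landau_Symbols"
begin

text \<open>
  The Hilbert space is a type of sort \<open>{real_inner, complete_space}\<close>, and a set-valued operator
  on it is a function \<open>'a \<Rightarrow> 'a set\<close>.
\<close>

definition gra :: "('a \<Rightarrow> 'a set) \<Rightarrow> ('a \<times> 'a) set" where
  "gra A = {(x, u). u \<in> A x}"

definition zer :: "('a \<Rightarrow> 'a::zero set) \<Rightarrow> 'a set" where
  "zer A = {x. 0 \<in> A x}"

definition comonotone :: "real \<Rightarrow> ('a::real_inner \<Rightarrow> 'a set) \<Rightarrow> bool" where
  "comonotone \<rho> A \<longleftrightarrow>
     (\<forall>(x, u) \<in> gra A. \<forall>(y, v) \<in> gra A. (x - y) \<bullet> (u - v) \<ge> \<rho> * (norm (u - v))\<^sup>2)"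

definition maximally_comonotone :: "real \<Rightarrow> ('a::real_inner \<Rightarrow> 'a set) \<Rightarrow> bool" where
  "maximally_comonotone \<rho> A \<longleftrightarrow>
     comonotone \<rho> A \<and> \<not> (\<exists>B. comonotone \<rho> B \<and> gra A \<subset> gra B)"

definition op_inverse :: "('a \<Rightarrow> 'b set) \<Rightarrow> 'b \<Rightarrow> 'a set" where
  "op_inverse A u = {x. u \<in> A x}"

definition resolvent :: "real \<Rightarrow> ('a::real_vector \<Rightarrow> 'a set) \<Rightarrow> 'a \<Rightarrow> 'a set" where
  "resolvent \<eta> A = op_inverse (\<lambda>y. {y + \<eta> *\<^sub>R u | u. u \<in> A y})"

text \<open>
  The Yosida regularization as a map. It is meaningful when the resolvent is single-valued with
  full domain, as it is for a maximally \<open>\<rho>\<close>-comonotone \<open>A\<close> and \<open>\<eta> > max (-2\<rho>) 0\<close>;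
  \<^const>\<open>the_elem\<close> then picks the unique element of the resolvent at \<open>x\<close>.
\<close>

definition yosida :: "real \<Rightarrow> ('a::real_vector \<Rightarrow> 'a set) \<Rightarrow> 'a \<Rightarrow> 'a" where
  "yosida \<eta> A x = (1 / \<eta>) *\<^sub>R (x - the_elem (resolvent \<eta> A x))"

text \<open>The unique zero of \<open>yosida \<eta> A + e Id\<close>.\<close>

definition yosida_reg_zero :: "real \<Rightarrow> ('a::real_vector \<Rightarrow> 'a set) \<Rightarrow> real \<Rightarrow> 'a" where
  "yosida_reg_zero \<eta> A e = (THE z. yosida \<eta> A z + e *\<^sub>R z = 0)"

text \<open>
  Absolute continuity on \<open>[a, b]\<close>. A finite family of intervals is a finite set of pairs of
  endpoints, and the open intervals are required to be pairwise disjoint.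
\<close>

definition abs_continuous_on :: "real \<Rightarrow> real \<Rightarrow> (real \<Rightarrow> 'a::real_normed_vector) \<Rightarrow> bool" where
  "abs_continuous_on a b f \<longleftrightarrow>
     (\<forall>e>0. \<exists>d>0. \<forall>I :: (real \<times> real) set.
        finite I \<longrightarrow>
        (\<forall>(r, s) \<in> I. a \<le> r \<and> r \<le> s \<and> s \<le> b) \<longrightarrow>
        pairwise (\<lambda>(r, s) (r', s'). {r<..<s} \<inter> {r'<..<s'} = {}) I \<longrightarrow>
        (\<Sum>(r, s) \<in> I. s - r) < d \<longrightarrow>
        (\<Sum>(r, s) \<in> I. norm (f s - f r)) < e)"

definition locally_abs_continuous :: "real \<Rightarrow> (real \<Rightarrow> 'a::real_normed_vector) \<Rightarrow> bool" where
  "locally_abs_continuous t\<^sub>0 f \<longleftrightarrow> (\<forall>T>t\<^sub>0. abs_continuous_on t\<^sub>0 T f)"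

text \<open>
  The derivative of a function on \<open>[t\<^sub>0, \<infinity>)\<close>, one-sided at \<open>t\<^sub>0\<close>. Trajectories have type
  \<open>real \<Rightarrow> 'a\<close>, and their values to the left of \<open>t\<^sub>0\<close> are irrelevant.
\<close>

definition deriv_from :: "real \<Rightarrow> (real \<Rightarrow> 'a::real_normed_vector) \<Rightarrow> real \<Rightarrow> 'a" where
  "deriv_from t\<^sub>0 f t = vector_derivative f (at t within {t\<^sub>0..})"

text \<open>
  Since \<^const>\<open>vector_derivative\<close> is total, the existence of the derivatives in the equation is
  stated explicitly. As the first derivative is to be locally absolutely continuous, it exists at
  every \<open>t \<ge> t\<^sub>0\<close>; the other two derivatives in the equation exist almost everywhere.
\<close>

definition strong_global_solution ::
  "real \<Rightarrow> ('a::real_inner \<Rightarrow> 'a set) \<Rightarrow> real \<Rightarrow> real \<Rightarrow> real \<Rightarrow> real \<Rightarrow> (real \<Rightarrow> 'a) \<Rightarrow> bool" where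
  "strong_global_solution \<eta> A \<delta> \<gamma> q t\<^sub>0 x \<longleftrightarrow>
     (\<forall>t\<ge>t\<^sub>0. x differentiable (at t within {t\<^sub>0..})) \<and>
     locally_abs_continuous t\<^sub>0 x \<and>
     locally_abs_continuous t\<^sub>0 (deriv_from t\<^sub>0 x) \<and>
     (let F = (\<lambda>t. yosida \<eta> A (x t) + (1 / t powr q) *\<^sub>R x t) in
      AE t in lebesgue. t \<ge> t\<^sub>0 \<longrightarrow>
        deriv_from t\<^sub>0 x differentiable (at t within {t\<^sub>0..}) \<and>
        F differentiable (at t within {t\<^sub>0..}) \<and>
        deriv_from t\<^sub>0 (deriv_from t\<^sub>0 x) t
          + (\<delta> / t powr (q / 2)) *\<^sub>R deriv_from t\<^sub>0 x t
          + ((1 / \<gamma>) * t powr (q / 2)) *\<^sub>R deriv_from t\<^sub>0 F t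
          + F t = 0)"

end

theory Submission
  imports Defs
begin

text \<open>
  Write \<open>M\<close> for the Yosida regularization, which is monotone and Lipschitz, and
  \<open>F(t) = M x(t) + \<epsilon>(t) x(t)\<close>. The estimate concerns the velocity and avoids differentiating
  \<open>x\<^bsub>\<epsilon>(t)\<^esub>\<close>. Put \<open>y = F / (\<delta>\<surd>\<epsilon>)\<close>, \<open>z = x' + y\<close> and \<open>b = \<gamma>\<delta> / (\<delta> - \<gamma>)\<close>. In the energy
  \<open>V = \<delta>\<parallel>y\<parallel>\<^sup>2/2 + b\<parallel>z\<parallel>\<^sup>2/2\<close> the terms with \<open>F'\<close> combine to \<open>- \<langle>F', x'\<rangle> / \<surd>\<epsilon>\<close>, because \<open>\<delta> > \<gamma>\<close> makes the
  linear part of the system passive. Monotonicity gives \<open>\<langle>F', x'\<rangle> \<ge> \<epsilon>\<parallel>x'\<parallel>\<^sup>2 + \<epsilon>'\<langle>x, x'\<rangle>\<close>, and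
  \<open>\<parallel>x\<parallel> \<le> \<parallel>F\<parallel>/\<epsilon> + const\<close>, so \<open>(t\<^sup>2 V)' \<le> \<surd>\<epsilon> (const - c t\<^sup>2 V)\<close> for large \<open>t\<close> and \<open>t\<^sup>2 V\<close> is bounded.
  Hence \<open>\<parallel>x'\<parallel> = O(1/t)\<close> and \<open>\<parallel>F\<parallel> = O(\<surd>\<epsilon>/t)\<close>. As \<open>M + \<epsilon> Id\<close> is strongly monotone,
  \<open>\<parallel>x - x\<^bsub>\<epsilon>(t)\<^esub>\<parallel> \<le> \<parallel>F\<parallel>/\<epsilon>\<close> and \<open>\<parallel>M x + \<epsilon> x\<^bsub>\<epsilon>(t)\<^esub>\<parallel> \<le> 2\<parallel>F\<parallel>\<close>. For
  \<open>0 < q < 1\<close> these rates are stronger than the claimed ones.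
\<close>

section \<open>The Yosida regularization\<close>

text \<open>The functional r + |z|^2/2 is strongly convex in z, so the z-parts of a minimizing
  sequence are Cauchy; the r-parts then converge because the values do. The conclusion is the
  first-order optimality condition at the minimizer.\<close>

lemma closed_convex_quadratic_min:
  fixes E :: "('b::{real_inner, complete_space} \<times> real) set"
  assumes "closed E" "convex E" "E \<noteq> {}"
    and bdd: "\<And>z r. (z, r) \<in> E \<Longrightarrow> 0 \<le> r + (norm z)\<^sup>2 / 2"
  obtains z0 r0 where "(z0, r0) \<in> E" "\<And>z r. (z, r) \<in> E \<Longrightarrow> r0 \<le> r + z0 \<bullet> (z - z0)"
proof -
  define \<theta> where "\<theta> e = snd e + (norm (fst e))\<^sup>2 / 2" for e :: "'b \<times> real"
  define m where "m = Inf (\<theta> ` E)"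
  have bb: "bdd_below (\<theta> ` E)"
    using bdd by (intro bdd_belowI[of _ 0]) (auto simp: \<theta>_def)
  have m_le: "m \<le> \<theta> e" if "e \<in> E" for e
    unfolding m_def using that bb by (simp add: cInf_lower)
  have "\<exists>e\<in>E. \<theta> e < m + 1 / real (Suc n)" for n
  proof -
    have "Inf (\<theta> ` E) < m + 1 / real (Suc n)" by (simp add: m_def)
    then show ?thesis using \<open>E \<noteq> {}\<close> bb by (auto simp: cInf_less_iff)
  qed
  then obtain e where eE: "\<And>n. e n \<in> E" and e: "\<And>n. \<theta> (e n) < m + 1 / real (Suc n)"
    by metis
  define z where "z n = fst (e n)" for n
  define r where "r n = snd (e n)" for n
  \<comment> \<open>The midpoint of two members lies in \<open>E\<close>, so its value is at least
    \<open>m\<close>; by the parallelogram law that value is the mean of the two values minus |z i -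
    z j|^2/8.\<close>
  have mid: "(norm (z i - z j))\<^sup>2 \<le> 4 * (\<theta> (e i) + \<theta> (e j) - 2 * m)" for i j
  proof -
    have "(1/2) *\<^sub>R e i + (1/2) *\<^sub>R e j \<in> E"
      using \<open>convex E\<close> eE by (intro convexD) auto
    from m_le[OF this] show ?thesis
      by (simp add: \<theta>_def z_def power2_norm_eq_inner inner_simps inner_commute field_simps)
  qed
  have "\<exists>N. \<forall>i\<ge>N. \<forall>j\<ge>N. norm (z i - z j) < \<epsilon>" if "\<epsilon> > 0" for \<epsilon> :: real
  proof -
    obtain N where N: "1 / real (Suc N) < \<epsilon>\<^sup>2 / 8"
      using reals_Archimedean[of "\<epsilon>\<^sup>2 / 8"] \<open>\<epsilon> > 0\<close> by (auto simp: inverse_eq_divide)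
    have "norm (z i - z j) < \<epsilon>" if "i \<ge> N" "j \<ge> N" for i j
    proof -
      have "1 / real (Suc k) < \<epsilon>\<^sup>2 / 8" if "k \<ge> N" for k
        using N that by (smt (verit) frac_le of_nat_0_less_iff of_nat_mono zero_less_Suc Suc_le_mono)
      with that e[of i] e[of j] have "\<theta> (e i) < m + \<epsilon>\<^sup>2 / 8" "\<theta> (e j) < m + \<epsilon>\<^sup>2 / 8"
        by fastforce+
      with mid[of i j] have "(norm (z i - z j))\<^sup>2 < \<epsilon>\<^sup>2" by argo
      then show ?thesis using \<open>\<epsilon> > 0\<close> by (simp add: power2_less_imp_less)
    qed
    then show ?thesis by blast
  qed
  then have "Cauchy z" by (simp add: Cauchy_iff)
  then obtain z0 where z0: "z \<longlonglongrightarrow> z0" by (auto simp: Cauchy_convergent_iff convergent_def)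
  have "(\<lambda>n. \<theta> (e n)) \<longlonglongrightarrow> m"
  proof (rule tendsto_sandwich[where f = "\<lambda>_. m" and h = "\<lambda>n. m + 1 / real (Suc n)"])
    show "(\<lambda>n. m + 1 / real (Suc n)) \<longlonglongrightarrow> m"
      using tendsto_add[OF tendsto_const[of m] LIMSEQ_inverse_real_of_nat]
      by (simp add: inverse_eq_divide)
  qed (use m_le eE less_imp_le[OF e] in \<open>auto intro!: always_eventually simp del: of_nat_Suc\<close>)
  then have "(\<lambda>n. \<theta> (e n) - (norm (z n))\<^sup>2 / 2) \<longlonglongrightarrow> m - (norm z0)\<^sup>2 / 2"
    by (intro tendsto_intros z0) auto
  then have r0: "r \<longlonglongrightarrow> m - (norm z0)\<^sup>2 / 2"
    by (simp add: \<theta>_def z_def r_def[abs_def])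
  define r0 where "r0 = m - (norm z0)\<^sup>2 / 2"
  have "e = (\<lambda>n. (z n, r n))" by (auto simp: z_def r_def)
  then have "e \<longlonglongrightarrow> (z0, r0)" using z0 r0 by (auto simp: r0_def intro: tendsto_Pair)
  then have in_E: "(z0, r0) \<in> E"
    using \<open>closed E\<close> eE by (metis closed_sequentially)
  have "r0 \<le> r + z0 \<bullet> (z - z0)" if "(z, r) \<in> E" for z r
  proof -
    \<comment> \<open>Optimality is tested on the segment towards \<open>(z, r)\<close>: the
      comparison is divided by \<open>t\<close>, and \<open>t\<close> tends to 0 from the right
      afterwards.\<close>
    have "0 \<le> r - r0 + z0 \<bullet> (z - z0) + t * ((norm (z - z0))\<^sup>2 / 2)" if t: "0 < t" "t \<le> 1" for t :: real
    proof -
      have "(1 - t) *\<^sub>R (z0, r0) + t *\<^sub>R (z, r) \<in> E"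
        using \<open>convex E\<close> in_E \<open>(z, r) \<in> E\<close> t by (intro convexD) auto
      from m_le[OF this] have "m \<le> r0 + t * (r - r0) + (norm (z0 + t *\<^sub>R (z - z0)))\<^sup>2 / 2"
        by (simp add: \<theta>_def algebra_simps)
      moreover have "(norm (z0 + t *\<^sub>R (z - z0)))\<^sup>2
          = (norm z0)\<^sup>2 + 2 * t * (z0 \<bullet> (z - z0)) + t\<^sup>2 * (norm (z - z0))\<^sup>2"
        unfolding power2_norm_eq_inner
        by (simp add: inner_add_left inner_add_right inner_commute power2_eq_square algebra_simps)
      ultimately have "0 \<le> t * (r - r0 + z0 \<bullet> (z - z0) + t * ((norm (z - z0))\<^sup>2 / 2))"
        by (simp add: r0_def algebra_simps power2_eq_square)
      then show ?thesis using t by (simp add: zero_le_mult_iff)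
    qed
    moreover have "((\<lambda>t. r - r0 + z0 \<bullet> (z - z0) + t * ((norm (z - z0))\<^sup>2 / 2))
        \<longlongrightarrow> r - r0 + z0 \<bullet> (z - z0) + 0 * ((norm (z - z0))\<^sup>2 / 2)) (at_right 0)"
      by (intro tendsto_intros)
    ultimately have "0 \<le> r - r0 + z0 \<bullet> (z - z0) + 0 * ((norm (z - z0))\<^sup>2 / 2)"
      by (intro tendsto_lowerbound[where F = "at_right (0::real)"])
        (auto simp: eventually_at_right_field intro!: exI[of _ 1])
    then show ?thesis by simp
  qed
  with in_E show ?thesis using that by blast
qed

text \<open>
  Minty's theorem. A minimizer \<open>(x\<^sub>0, u\<^sub>0)\<close> of Fitzpatrick's function
  \<open>sup\<^bsub>(a,b)\<in>G\<^esub> (\<langle>x,b\<rangle> + \<langle>a,u\<rangle> - \<langle>a,b\<rangle>)\<close> plus \<open>(\<parallel>x\<parallel>\<^sup>2 + \<parallel>u\<parallel>\<^sup>2)/2\<close> satisfies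
  \<open>\<langle>a + u\<^sub>0, b + x\<^sub>0\<rangle> \<ge> \<parallel>x\<^sub>0 + u\<^sub>0\<parallel>\<^sup>2\<close> on \<open>G\<close>. The set \<open>E\<close> is the epigraph of that function.
\<close>

lemma maximal_monotone_Minty:
  fixes G :: "('a::{real_inner, complete_space} \<times> 'a) set"
  assumes mono: "\<And>a b a' b'. (a, b) \<in> G \<Longrightarrow> (a', b') \<in> G \<Longrightarrow> 0 \<le> (a - a') \<bullet> (b - b')"
    and maxi: "\<And>p u. (\<And>a b. (a, b) \<in> G \<Longrightarrow> 0 \<le> (p - a) \<bullet> (u - b)) \<Longrightarrow> (p, u) \<in> G"
  obtains p where "(p, - p) \<in> G"
proof -
  define E where "E = (\<Inter>(a, b)\<in>G. {e :: ('a \<times> 'a) \<times> real. fst (fst e) \<bullet> b + a \<bullet> snd (fst e) - a \<bullet> b \<le> snd e})"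
  have in_E: "((x, u), r) \<in> E \<longleftrightarrow> (\<forall>(a, b)\<in>G. x \<bullet> b + a \<bullet> u - a \<bullet> b \<le> r)" for x u r
    by (auto simp: E_def)
  \<comment> \<open>Fitzpatrick's function dominates the pairing: if \<open>r\<close> were below
    \<open>x \<bullet> u\<close>, then \<open>(x, u)\<close> would be monotonically related to all
    of \<open>G\<close>, hence a member by maximality, and its own inequality would contradict
    this.\<close>
  have E_ge: "x \<bullet> u \<le> r" if "((x, u), r) \<in> E" for x u r
  proof (rule ccontr)
    assume less: "\<not> x \<bullet> u \<le> r"
    have "(x, u) \<in> G"
    proof (rule maxi)
      fix a b assume "(a, b) \<in> G"
      with that have "x \<bullet> b + a \<bullet> u - a \<bullet> b \<le> r" by (auto simp: in_E)
      with less show "0 \<le> (x - a) \<bullet> (u - b)" by (simp add: inner_simps)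
    qed
    with that less show False by (auto simp: in_E)
  qed
  have G_E: "((a, b), a \<bullet> b) \<in> E" if "(a, b) \<in> G" for a b
    unfolding in_E using mono[OF that] by (force simp: inner_simps)
  have "G \<noteq> {}" using maxi by blast
  then have "E \<noteq> {}" using G_E by fast
  have "closed E"
    unfolding E_def by (intro closed_INT ballI) (auto intro!: closed_Collect_le continuous_intros)
  have "convex E"
    unfolding E_def
  proof (intro convex_INT)
    fix ab assume "ab \<in> G"
    obtain a b where [simp]: "ab = (a, b)" by fastforce
    have "x1 \<bullet> b * u + x2 \<bullet> b * v + (a \<bullet> u1 * u + a \<bullet> u2 * v) - a \<bullet> b \<le> r1 * u + r2 * v"
      if "x1 \<bullet> b + a \<bullet> u1 - a \<bullet> b \<le> r1" "x2 \<bullet> b + a \<bullet> u2 - a \<bullet> b \<le> r2"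
        and uv: "0 \<le> u" "0 \<le> v" "u + v = 1" for x1 u1 r1 x2 u2 r2 u v
    proof -
      have "(x1 \<bullet> b + a \<bullet> u1 - a \<bullet> b) * u + (x2 \<bullet> b + a \<bullet> u2 - a \<bullet> b) * v \<le> r1 * u + r2 * v"
        using that by (intro add_mono mult_right_mono)
      moreover have "a \<bullet> b = (a \<bullet> b) * u + (a \<bullet> b) * v"
        using uv by (simp flip: distrib_left)
      ultimately show ?thesis by (simp add: algebra_simps)
    qed
    then show "convex (case ab of (a, b) \<Rightarrow> {e. fst (fst e) \<bullet> b + a \<bullet> snd (fst e) - a \<bullet> b \<le> snd e})"
      by (auto simp: convex_def inner_simps mult.commute)
  qed
  have "0 \<le> r + (norm z)\<^sup>2 / 2" if "(z, r) \<in> E" for z r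
  proof (cases z)
    case (Pair x u)
    then have "x \<bullet> u \<le> r" using that E_ge by blast
    moreover have "0 \<le> (norm (x + u))\<^sup>2" by simp
    then have "0 \<le> x \<bullet> u + (x \<bullet> x + u \<bullet> u) / 2"
      by (simp add: power2_norm_eq_inner inner_simps inner_commute field_simps)
    ultimately show ?thesis
      using Pair by (simp add: power2_norm_eq_inner)
  qed
  with \<open>closed E\<close> \<open>convex E\<close> \<open>E \<noteq> {}\<close>
  obtain z0 r0 where z0E: "(z0, r0) \<in> E" and z0: "\<And>z r. (z, r) \<in> E \<Longrightarrow> r0 \<le> r + z0 \<bullet> (z - z0)"
    by (rule closed_convex_quadratic_min) auto
  obtain x0 u0 where [simp]: "z0 = (x0, u0)" by fastforce
  \<comment> \<open>Optimality is applied at the epigraph point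
    \<open>((a, b), a \<bullet> b)\<close>, and \<open>r0\<close> is bounded below by
    \<open>x0 \<bullet> u0\<close>.\<close>
  have key: "(norm (x0 + u0))\<^sup>2 \<le> (- u0 - a) \<bullet> (- x0 - b)" if "(a, b) \<in> G" for a b
    using z0[OF G_E[OF that]] E_ge[of x0 u0 r0] z0E
    by (simp add: power2_norm_eq_inner inner_simps inner_commute)
  \<comment> \<open>The right-hand side of \<open>key\<close> is nonnegative, so maximality applies;
    inserting this very pair into \<open>key\<close> makes |x0 + u0| vanish.\<close>
  have "(- u0, - x0) \<in> G"
    by (rule maxi) (use key in \<open>meson order_trans zero_le_power2\<close>)
  with key[OF this] have "x0 = - u0"
    by (simp add: eq_neg_iff_add_eq_0)
  with \<open>(- u0, - x0) \<in> G\<close> show ?thesis using that[of x0] by simp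
qed

text \<open>Adjoining the pair \<open>(p, u)\<close> to the graph preserves comonotonicity, so
  maximality forbids that it be new.\<close>

lemma maximally_comonotone_graI:
  assumes "maximally_comonotone \<rho> A"
    and rel: "\<And>a b. b \<in> A a \<Longrightarrow> \<rho> * (norm (u - b))\<^sup>2 \<le> (p - a) \<bullet> (u - b)"
  shows "u \<in> A p"
proof (rule ccontr)
  assume "u \<notin> A p"
  define B where "B x = (if x = p then insert u (A x) else A x)" for x
  have gra_B: "gra B = insert (p, u) (gra A)" by (auto simp: gra_def B_def split: if_splits)
  have "\<rho> * (norm (b - u))\<^sup>2 \<le> (a - p) \<bullet> (b - u)" if "b \<in> A a" for a b
    using rel[OF that] by (simp add: norm_minus_commute inner_diff_left inner_diff_right)
  with rel have "comonotone \<rho> B"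
    using assms(1) unfolding maximally_comonotone_def comonotone_def gra_B
    by (auto simp: gra_def)
  moreover have "gra A \<subset> gra B" using \<open>u \<notin> A p\<close> unfolding gra_B by (auto simp: gra_def)
  ultimately show False using assms(1) by (auto simp: maximally_comonotone_def)
qed

section \<open>Resolvent, cocoercivity and regularized zeros\<close>

locale yosida_regularization =
  fixes A :: "'a::{real_inner, complete_space} \<Rightarrow> 'a set" and \<rho> \<eta> :: real
  assumes max_comonotone: "maximally_comonotone \<rho> A"
    and eta: "\<eta> > max (- 2 * \<rho>) 0"
begin

abbreviation M :: "'a \<Rightarrow> 'a" where "M \<equiv> yosida \<eta> A"

text \<open>The sum \<rho> + \<eta> will be the cocoercivity constant of \<open>M\<close>. For
  negative \<rho> it is positive because \<eta> > -2\<rho> > -\<rho>.\<close>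

lemma eta_pos: "\<eta> > 0" and rho_eta_pos: "\<rho> + \<eta> > 0"
  using eta by auto

lemma comonotoneD:
  assumes "u \<in> A x" "v \<in> A y"
  shows "\<rho> * (norm (u - v))\<^sup>2 \<le> (x - y) \<bullet> (u - v)"
  using max_comonotone assms by (auto simp: maximally_comonotone_def comonotone_def gra_def)

lemma resolvent_iff: "p \<in> resolvent \<eta> A x \<longleftrightarrow> (\<exists>u\<in>A p. x = p + \<eta> *\<^sub>R u)"
  by (auto simp: resolvent_def op_inverse_def)

text \<open>The map (p, u) to (p - \<rho> u - z, (\<rho> + \<eta>) u) turns the graph of
  \<open>A\<close> into a maximal monotone set \<open>G\<close>. The antidiagonal pair that Minty's
  theorem finds in \<open>G\<close> satisfies p - \<rho> u - z = - (\<rho> + \<eta>) u, that is, p +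
  \<eta> u = z.\<close>

lemma resolvent_nonempty: "resolvent \<eta> A z \<noteq> {}"
proof -
  define \<beta> where "\<beta> = \<rho> + \<eta>"
  have "\<beta> > 0" using rho_eta_pos by (simp add: \<beta>_def)
  define G where "G = {(p - \<rho> *\<^sub>R u - z, \<beta> *\<^sub>R u) | p u. u \<in> A p}"
  have shift: "(p - \<rho> *\<^sub>R u - (a - \<rho> *\<^sub>R b)) \<bullet> (\<beta> *\<^sub>R u - \<beta> *\<^sub>R b)
      = \<beta> * ((p - a) \<bullet> (u - b) - \<rho> * (norm (u - b))\<^sup>2)" for p u a b
    by (simp add: power2_norm_eq_inner algebra_simps inner_simps)
  obtain p where "(p, - p) \<in> G"
  proof (rule maximal_monotone_Minty[of G])
    show "0 \<le> (a - a') \<bullet> (b - b')" if "(a, b) \<in> G" "(a', b') \<in> G" for a b a' b'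
      using that comonotoneD \<open>\<beta> > 0\<close> by (auto simp: G_def shift)
  next
    fix p' u'
    assume rel: "0 \<le> (p' - a) \<bullet> (u' - b)" if "(a, b) \<in> G" for a b
    define u where "u = u' /\<^sub>R \<beta>"
    define p where "p = p' + \<rho> *\<^sub>R u + z"
    have eqs: "u' = \<beta> *\<^sub>R u" "p' = p - \<rho> *\<^sub>R u - z"
      using \<open>\<beta> > 0\<close> by (auto simp: u_def p_def)
    have "u \<in> A p"
    proof (rule maximally_comonotone_graI[OF max_comonotone])
      fix a b assume "b \<in> A a"
      then have "(a - \<rho> *\<^sub>R b - z, \<beta> *\<^sub>R b) \<in> G" by (auto simp: G_def)
      from rel[OF this] show "\<rho> * (norm (u - b))\<^sup>2 \<le> (p - a) \<bullet> (u - b)"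
        using \<open>\<beta> > 0\<close> by (simp add: eqs shift zero_le_mult_iff)
    qed
    then show "(p', u') \<in> G" by (auto simp: G_def eqs)
  qed
  then obtain a u where "u \<in> A a" "p = a - \<rho> *\<^sub>R u - z" "- p = \<beta> *\<^sub>R u"
    by (auto simp: G_def)
  then have "z = a - \<rho> *\<^sub>R u + (\<rho> + \<eta>) *\<^sub>R u"
    by (metis \<beta>_def add.commute diff_add_cancel diff_conv_add_uminus minus_diff_eq)
  then have "z = a + \<eta> *\<^sub>R u" by (simp add: scaleR_add_left)
  with \<open>u \<in> A a\<close> show ?thesis using resolvent_iff by blast
qed

text \<open>Single-valuedness of the resolvent: p - p' = - \<eta> (u - v) turns comonotonicity into
  (\<rho> + \<eta>) |u - v|^2 \<le> 0.\<close>

lemma comonotone_shift_unique: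
  assumes "u \<in> A p" "v \<in> A p'" "p + \<eta> *\<^sub>R u = p' + \<eta> *\<^sub>R v"
  shows "u = v" "p = p'"
proof -
  have "p - p' = - (\<eta> *\<^sub>R (u - v))" using assms(3) by (simp add: algebra_simps)
  with comonotoneD[OF assms(1,2)] have "(\<rho> + \<eta>) * (norm (u - v))\<^sup>2 \<le> 0"
    by (simp add: power2_norm_eq_inner algebra_simps inner_simps)
  with rho_eta_pos have "(norm (u - v))\<^sup>2 \<le> 0" by (simp add: mult_le_0_iff)
  then show "u = v" by simp
  with assms(3) show "p = p'" by simp
qed

lemma yosida_eqI:
  assumes "u \<in> A p" "x = p + \<eta> *\<^sub>R u"
  shows "M x = u"
proof -
  have "resolvent \<eta> A x = {p}"
    using assms comonotone_shift_unique(2) by (auto simp: resolvent_iff)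
  with assms(2) eta_pos show ?thesis by (simp add: yosida_def)
qed

text \<open>The point \<open>x - \<eta> *\<^sub>R M x\<close> is the resolvent at \<open>x\<close>;
  this membership carries comonotonicity of \<open>A\<close> over to \<open>M\<close>.\<close>

lemma yosida_in: "M x \<in> A (x - \<eta> *\<^sub>R M x)"
proof -
  obtain p u where pu: "u \<in> A p" "x = p + \<eta> *\<^sub>R u"
    using resolvent_nonempty resolvent_iff by blast
  with yosida_eqI show ?thesis by simp
qed

lemma yosida_cocoercive: "(\<rho> + \<eta>) * (norm (M x - M y))\<^sup>2 \<le> (x - y) \<bullet> (M x - M y)"
  using comonotoneD[OF yosida_in[of x] yosida_in[of y]]
  by (simp add: power2_norm_eq_inner algebra_simps inner_simps)

lemma yosida_monotone: "0 \<le> (x - y) \<bullet> (M x - M y)"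
  using yosida_cocoercive[of x y] rho_eta_pos
  by (smt (verit) mult_nonneg_nonneg zero_le_power2)

lemma yosida_lipschitz: "norm (M x - M y) \<le> 1 / (\<rho> + \<eta>) * norm (x - y)"
proof (cases "M x = M y")
  case False
  have "(\<rho> + \<eta>) * (norm (M x - M y))\<^sup>2 \<le> norm (x - y) * norm (M x - M y)"
    using yosida_cocoercive norm_cauchy_schwarz order_trans by blast
  with False have "(\<rho> + \<eta>) * norm (M x - M y) \<le> norm (x - y)"
    by (simp add: power2_eq_square flip: mult.assoc)
  with rho_eta_pos show ?thesis by (simp add: field_simps)
qed (use rho_eta_pos in simp)

lemma yosida_zero:
  assumes "zer A \<noteq> {}"
  obtains p where "M p = 0"
proof -
  obtain p where "0 \<in> A p" using assms by (auto simp: zer_def)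
  then have "M p = 0" by (intro yosida_eqI) auto
  then show ?thesis by (rule that)
qed

text \<open>\<open>M + e Id\<close> is strongly monotone with modulus \<open>e\<close>;
  Cauchy-Schwarz and division by |x - y| give the bound. It yields uniqueness of the regularized
  zero and estimates distances by residuals.\<close>

lemma strong_monotone_bound:
  assumes "e > 0"
  shows "e * norm (x - y) \<le> norm ((M x + e *\<^sub>R x) - (M y + e *\<^sub>R y))"
proof -
  have "(x - y) \<bullet> ((M x + e *\<^sub>R x) - (M y + e *\<^sub>R y)) = (x - y) \<bullet> (M x - M y) + e * (norm (x - y))\<^sup>2"
    by (simp add: power2_norm_eq_inner algebra_simps inner_simps)
  then have "e * (norm (x - y))\<^sup>2 \<le> (x - y) \<bullet> ((M x + e *\<^sub>R x) - (M y + e *\<^sub>R y))"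
    using yosida_monotone[of x y] by simp
  also have "\<dots> \<le> norm (x - y) * norm ((M x + e *\<^sub>R x) - (M y + e *\<^sub>R y))"
    by (rule norm_cauchy_schwarz)
  finally show ?thesis
    by (cases "x = y") (simp_all add: power2_eq_square mult.left_commute)
qed

text \<open>A zero of \<open>M + e Id\<close> is a fixed point of \<open>T\<close>. With
  \<open>s\<close> the cocoercivity constant, Id - s M is nonexpansive, so \<open>T\<close> is a
  contraction with factor 1/(1 + s e). Uniqueness is what evaluates the definite
  description.\<close>

lemma yosida_reg_zero:
  assumes "e > 0"
  shows "M (yosida_reg_zero \<eta> A e) + e *\<^sub>R yosida_reg_zero \<eta> A e = 0"
proof -
  define s where "s = \<rho> + \<eta>"
  have "s > 0" using rho_eta_pos by (simp add: s_def)
  define T where "T x = (1 / (1 + s * e)) *\<^sub>R (x - s *\<^sub>R M x)" for x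
  have nonexp: "norm ((x - s *\<^sub>R M x) - (y - s *\<^sub>R M y)) \<le> norm (x - y)" for x y
  proof (rule power2_le_imp_le)
    have "(norm ((x - s *\<^sub>R M x) - (y - s *\<^sub>R M y)))\<^sup>2
        = (norm (x - y))\<^sup>2 - s * (2 * ((x - y) \<bullet> (M x - M y)) - s * (norm (M x - M y))\<^sup>2)"
      by (simp add: power2_norm_eq_inner algebra_simps inner_simps inner_commute)
    moreover have "0 \<le> s * (2 * ((x - y) \<bullet> (M x - M y)) - s * (norm (M x - M y))\<^sup>2)"
      using yosida_cocoercive[of x y] yosida_monotone[of x y] \<open>s > 0\<close>
      by (intro mult_nonneg_nonneg) (auto simp: s_def)
    ultimately show "(norm ((x - s *\<^sub>R M x) - (y - s *\<^sub>R M y)))\<^sup>2 \<le> (norm (x - y))\<^sup>2" by simp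
  qed simp
  have "\<exists>!x. x \<in> UNIV \<and> T x = x"
  proof (rule Banach_fix)
    have "s * e > 0" using \<open>s > 0\<close> assms by simp
    then show "0 \<le> 1 / (1 + s * e)" "1 / (1 + s * e) < 1" by auto
    show "dist (T x) (T y) \<le> 1 / (1 + s * e) * dist x y" if "x \<in> UNIV" "y \<in> UNIV" for x y
      unfolding T_def dist_norm scaleR_diff_right[symmetric] norm_scaleR
      using nonexp \<open>s * e > 0\<close> by (intro mult_mono) auto
  qed (auto intro: complete_UNIV)
  then obtain z where "T z = z" by blast
  have "s * e > 0" using \<open>s > 0\<close> assms by simp
  have "(1 + s * e) *\<^sub>R T z = z - s *\<^sub>R M z" using \<open>s * e > 0\<close> by (simp add: T_def)
  then have "s *\<^sub>R (M z + e *\<^sub>R z) = 0"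
    using \<open>T z = z\<close> by (simp add: algebra_simps)
  then have "M z + e *\<^sub>R z = 0" using \<open>s > 0\<close> by simp
  then show ?thesis
    unfolding yosida_reg_zero_def
  proof (rule theI)
    fix y assume "M y + e *\<^sub>R y = 0"
    with strong_monotone_bound[OF assms, of y z] \<open>M z + e *\<^sub>R z = 0\<close> assms show "y = z"
      by (simp add: mult_le_0_iff)
  qed
qed

end

section \<open>Absolutely continuous functions\<close>

text \<open>The side conditions of \<open>abs_continuous_on\<close> in one predicate. Disjointness
  of the open intervals lets neighbours share an endpoint, which gluing requires.\<close>

definition interval_family :: "real \<Rightarrow> real \<Rightarrow> (real \<times> real) set \<Rightarrow> bool" where
  "interval_family a b I \<longleftrightarrow> finite I \<and> (\<forall>(r, s)\<in>I. a \<le> r \<and> r \<le> s \<and> s \<le> b) \<and>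
     pairwise (\<lambda>(r, s) (r', s'). {r<..<s} \<inter> {r'<..<s'} = {}) I"

lemma interval_family_Un:
  assumes I: "interval_family u v I" and J: "interval_family v w J" and "u \<le> v" "v \<le> w"
  shows "interval_family u w (I \<union> J)"
proof -
  have "{fst p<..<snd p} \<inter> {fst p'<..<snd p'} = {}" if "p \<in> I \<union> J" "p' \<in> I \<union> J" "p \<noteq> p'" for p p'
  proof -
    have cross: "{fst p<..<snd p} \<inter> {fst p'<..<snd p'} = {}" if "p \<in> I" "p' \<in> J" for p p'
    proof -
      have "snd p \<le> v" "v \<le> fst p'" using that I J by (auto simp: interval_family_def)
      then show ?thesis by auto
    qed
    have "{fst p<..<snd p} \<inter> {fst p'<..<snd p'} = {}" if "p \<in> K" "p' \<in> K" "K \<in> {I, J}" for K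
      using that \<open>p \<noteq> p'\<close> I J by (auto simp: interval_family_def pairwise_def case_prod_unfold)
    with that cross[of p p'] cross[of p' p] show ?thesis by (auto simp: Int_commute)
  qed
  then show ?thesis
    using I J \<open>u \<le> v\<close> \<open>v \<le> w\<close>
    by (auto simp: interval_family_def pairwise_def case_prod_unfold intro: order_trans)
qed

lemma abs_continuous_on_iff:
  "abs_continuous_on a b f \<longleftrightarrow> (\<forall>e>0. \<exists>d>0. \<forall>I. interval_family a b I \<longrightarrow>
     (\<Sum>(r, s)\<in>I. s - r) < d \<longrightarrow> (\<Sum>(r, s)\<in>I. norm (f s - f r)) < e)"
  unfolding abs_continuous_on_def interval_family_def by (simp only: imp_conjL)

lemma abs_continuous_onE:
  assumes "abs_continuous_on a b f" "e > 0"
  obtains d where "d > 0" "\<And>I. interval_family a b I \<Longrightarrow>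
     (\<Sum>(r, s)\<in>I. s - r) < d \<Longrightarrow> (\<Sum>(r, s)\<in>I. norm (f s - f r)) < e"
  using assms unfolding abs_continuous_on_iff by blast

section \<open>Calculus of absolutely continuous functions\<close>

lemma abs_continuous_on_subset:
  assumes "abs_continuous_on a b f" "a \<le> a'" "b' \<le> b"
  shows "abs_continuous_on a' b' f"
proof -
  have "interval_family a b I" if "interval_family a' b' I" for I
    using that assms(2,3) by (fastforce simp: interval_family_def)
  with assms(1) show ?thesis unfolding abs_continuous_on_iff by meson
qed

text \<open>The common criterion behind the closure rules below: each of the two variation sums gets
  the budget e/(2C). A single dominating function is covered by taking \<open>f\<close> and
  \<open>g\<close> equal.\<close>

lemma abs_continuous_on_dominated:
  fixes f :: "real \<Rightarrow> 'b::real_normed_vector" and g :: "real \<Rightarrow> 'c::real_normed_vector"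
    and h :: "real \<Rightarrow> 'd::real_normed_vector"
  assumes f: "abs_continuous_on a b f" and g: "abs_continuous_on a b g"
    and dom: "\<And>r s. a \<le> r \<Longrightarrow> r \<le> s \<Longrightarrow> s \<le> b \<Longrightarrow>
      norm (h s - h r) \<le> C * (norm (f s - f r) + norm (g s - g r))"
    and "C > 0"
  shows "abs_continuous_on a b h"
  unfolding abs_continuous_on_iff
proof (intro allI impI)
  fix e :: real assume "e > 0"
  then have e': "e / (2 * C) > 0" using \<open>C > 0\<close> by simp
  obtain d1 where d1: "d1 > 0" "\<And>I. interval_family a b I \<Longrightarrow>
      (\<Sum>(r, s)\<in>I. s - r) < d1 \<Longrightarrow> (\<Sum>(r, s)\<in>I. norm (f s - f r)) < e / (2 * C)"
    by (rule abs_continuous_onE[OF f e']) blast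
  obtain d2 where d2: "d2 > 0" "\<And>I. interval_family a b I \<Longrightarrow>
      (\<Sum>(r, s)\<in>I. s - r) < d2 \<Longrightarrow> (\<Sum>(r, s)\<in>I. norm (g s - g r)) < e / (2 * C)"
    by (rule abs_continuous_onE[OF g e']) blast
  show "\<exists>d>0. \<forall>I. interval_family a b I \<longrightarrow>
      (\<Sum>(r, s)\<in>I. s - r) < d \<longrightarrow> (\<Sum>(r, s)\<in>I. norm (h s - h r)) < e"
  proof (intro exI[of _ "min d1 d2"] conjI allI impI)
    fix I assume I: "interval_family a b I" "(\<Sum>(r, s)\<in>I. s - r) < min d1 d2"
    have "(\<Sum>(r, s)\<in>I. norm (h s - h r)) \<le> (\<Sum>(r, s)\<in>I. C * (norm (f s - f r) + norm (g s - g r)))"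
      using I(1) dom by (intro sum_mono) (auto simp: interval_family_def)
    also have "\<dots> = C * ((\<Sum>(r, s)\<in>I. norm (f s - f r)) + (\<Sum>(r, s)\<in>I. norm (g s - g r)))"
      by (simp add: sum.distrib sum_distrib_left case_prod_unfold distrib_left)
    also have "\<dots> < C * (e / (2 * C) + e / (2 * C))"
      using I d1(2)[of I] d2(2)[of I] \<open>C > 0\<close> by (intro mult_strict_left_mono add_strict_mono) auto
    also have "\<dots> = e" using \<open>C > 0\<close> by simp
    finally show "(\<Sum>(r, s)\<in>I. norm (h s - h r)) < e" .
  qed (use d1(1) d2(1) in simp)
qed

lemma abs_continuous_on_add:
  assumes "abs_continuous_on a b f" "abs_continuous_on a b g"
  shows "abs_continuous_on a b (\<lambda>t. f t + g t)"
  using assms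
  by (rule abs_continuous_on_dominated[where C = 1])
    (auto simp: add_diff_add intro: norm_triangle_ineq)

lemma abs_continuous_on_lipschitz_compose:
  assumes "abs_continuous_on a b f" and L: "\<And>u v. norm (g u - g v) \<le> L * norm (u - v)"
  shows "abs_continuous_on a b (\<lambda>t. g (f t))"
\<comment> \<open>\<open>L\<close> may be zero or negative here, while the domination constant has
  to be strictly positive.\<close>
proof (rule abs_continuous_on_dominated[OF assms(1) assms(1), where C = "\<bar>L\<bar> + 1"])
  fix r s
  have "norm (g (f s) - g (f r)) \<le> L * norm (f s - f r)" by (rule L)
  also have "\<dots> \<le> (\<bar>L\<bar> + 1) * (norm (f s - f r) + norm (f s - f r))"
    by (intro mult_mono) auto
  finally show "norm (g (f s) - g (f r)) \<le> (\<bar>L\<bar> + 1) * (norm (f s - f r) + norm (f s - f r))" .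
qed simp

lemma abs_continuous_on_imp_continuous_on:
  assumes "abs_continuous_on a b f"
  shows "continuous_on {a..b} f"
  unfolding continuous_on_iff
proof (intro ballI allI impI)
  fix t e :: real assume t: "t \<in> {a..b}" and "e > 0"
  obtain d where d: "d > 0" "\<And>I. interval_family a b I \<Longrightarrow>
      (\<Sum>(r, s)\<in>I. s - r) < d \<Longrightarrow> (\<Sum>(r, s)\<in>I. norm (f s - f r)) < e"
    by (rule abs_continuous_onE[OF assms \<open>e > 0\<close>]) blast
  have *: "norm (f s - f r) < e" if "a \<le> r" "r \<le> s" "s \<le> b" "s - r < d" for r s
    using d(2)[of "{(r, s)}"] that by (simp add: interval_family_def)
  have "dist (f s) (f t) < e" if "s \<in> {a..b}" "dist s t < d" for s
    using *[of s t] *[of t s] that t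
    by (cases "s \<le> t") (auto simp: dist_norm norm_minus_commute)
  with d(1) show "\<exists>d>0. \<forall>s\<in>{a..b}. dist s t < d \<longrightarrow> dist (f s) (f t) < e" by blast
qed

lemma abs_continuous_on_bounded:
  assumes "abs_continuous_on a b f"
  obtains B where "B > 0" "\<And>t. a \<le> t \<Longrightarrow> t \<le> b \<Longrightarrow> norm (f t) \<le> B"
proof -
  have "bounded (f ` {a..b})"
    using assms by (intro compact_imp_bounded compact_continuous_image abs_continuous_on_imp_continuous_on) auto
  then show ?thesis using that by (auto simp: bounded_pos)
qed

text \<open>Both factors are bounded on the compact interval, and the increment of the product
  splits as for the product rule. One proof serves scalar multiples, inner products and real
  products.\<close>

lemma (in bounded_bilinear) abs_continuous_on:
  assumes f: "abs_continuous_on a b f" and g: "abs_continuous_on a b g"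
  shows "abs_continuous_on a b (\<lambda>t. prod (f t) (g t))"
proof -
  obtain F where F: "F > 0" "\<And>t. a \<le> t \<Longrightarrow> t \<le> b \<Longrightarrow> norm (f t) \<le> F"
    by (rule abs_continuous_on_bounded[OF f]) blast
  obtain G where G: "G > 0" "\<And>t. a \<le> t \<Longrightarrow> t \<le> b \<Longrightarrow> norm (g t) \<le> G"
    by (rule abs_continuous_on_bounded[OF g]) blast
  obtain K where K: "K > 0" "\<And>u v. norm (prod u v) \<le> norm u * norm v * K"
    using pos_bounded by blast
  show ?thesis
  proof (rule abs_continuous_on_dominated[OF f g])
    fix r s assume rs: "a \<le> r" "r \<le> s" "s \<le> b"
    have "prod (f s) (g s) - prod (f r) (g r) = prod (f s - f r) (g s) + prod (f r) (g s - g r)"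
      by (simp add: diff_left diff_right)
    also have "norm \<dots> \<le> norm (f s - f r) * norm (g s) * K + norm (f r) * norm (g s - g r) * K"
      by (rule norm_triangle_le) (intro add_mono K)
    also have "\<dots> \<le> norm (f s - f r) * (F + G) * K + (F + G) * norm (g s - g r) * K"
      using F(2)[of r] G(2)[of s] rs F(1) G(1) K(1)
      by (intro add_mono mult_right_mono mult_left_mono) auto
    finally show "norm (prod (f s) (g s) - prod (f r) (g r))
        \<le> (F + G) * K * (norm (f s - f r) + norm (g s - g r))"
      by (simp add: algebra_simps)
  qed (use F(1) G(1) K(1) in simp)
qed

lemmas abs_continuous_on_scaleR = bounded_bilinear.abs_continuous_on[OF bounded_bilinear_scaleR]
lemmas abs_continuous_on_inner = bounded_bilinear.abs_continuous_on[OF bounded_bilinear_inner]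
lemmas abs_continuous_on_mult = bounded_bilinear.abs_continuous_on[OF bounded_bilinear_mult]

lemma abs_continuous_on_id: "abs_continuous_on a b (\<lambda>t. t)"
proof -
  have "(\<Sum>(r, s)\<in>I. norm (s - r)) = (\<Sum>(r, s)\<in>I. s - r)" if "interval_family a b I" for I
    using that by (intro sum.cong) (auto simp: interval_family_def)
  then show ?thesis unfolding abs_continuous_on_iff by metis
qed

lemma abs_continuous_on_const: "abs_continuous_on a b (\<lambda>t. c)"
  by (rule abs_continuous_on_dominated[OF abs_continuous_on_id abs_continuous_on_id, where C = 1]) auto

lemma abs_continuous_on_C1:
  fixes f f' :: "real \<Rightarrow> real"
  assumes deriv: "\<And>t. t \<in> {a..b} \<Longrightarrow> (f has_real_derivative f' t) (at t within {a..b})"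
    and cont: "continuous_on {a..b} f'"
  shows "abs_continuous_on a b f"
proof -
  have "bounded (f' ` {a..b})"
    using cont by (intro compact_imp_bounded compact_continuous_image) auto
  then obtain B where B: "B > 0" "\<And>t. t \<in> {a..b} \<Longrightarrow> norm (f' t) \<le> B"
    by (auto simp: bounded_pos)
  show ?thesis
  proof (rule abs_continuous_on_dominated[OF abs_continuous_on_id abs_continuous_on_id])
    fix r s assume rs: "a \<le> r" "r \<le> s" "s \<le> b"
    have "norm (f s - f r) \<le> B * norm (s - r)"
      by (rule field_differentiable_bound[where S = "{a..b}" and f' = f']) (use rs deriv B(2) in auto)
    also have "\<dots> \<le> B * (norm (s - r) + norm (s - r))"
      using B(1) by simp
    finally show "norm (f s - f r) \<le> B * (norm (s - r) + norm (s - r))" .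
  qed (rule B)
qed

lemma abs_continuous_on_powr:
  assumes "a > 0"
  shows "abs_continuous_on a b (\<lambda>t. t powr c)"
proof (rule abs_continuous_on_C1[where f' = "\<lambda>t. c * t powr (c - 1)"])
  show "((\<lambda>t. t powr c) has_real_derivative c * t powr (c - 1)) (at t within {a..b})" if "t \<in> {a..b}" for t
    using that assms by (auto intro: has_field_derivative_at_within[OF has_real_derivative_powr])
  show "continuous_on {a..b} (\<lambda>t. c * t powr (c - 1))"
    using assms by (intro continuous_intros) auto
qed

section \<open>Monotonicity from the sign of the derivative almost everywhere\<close>

lemma negligible_open_cover:
  fixes N :: "real set"
  assumes "N \<in> null_sets lebesgue" "d > 0"
  obtains U where "open U" "N \<subseteq> U" "U \<in> lmeasurable" "measure lebesgue U < d"
proof -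
  obtain U where U: "open U" "N \<subseteq> U" "(U - N) \<in> lmeasurable" "emeasure lebesgue (U - N) < ennreal d"
    using sets_lebesgue_outer_open[of N d] assms by auto
  have eq: "emeasure lebesgue U = emeasure lebesgue (U - N)"
    using assms(1) U(1) by (simp add: emeasure_Diff_null_set)
  with U have "U \<in> lmeasurable" by (auto simp: fmeasurable_def)
  moreover have "measure lebesgue U < d"
    using U(4) emeasure_eq_measure2[OF \<open>U \<in> lmeasurable\<close>]
    unfolding eq[symmetric] by (simp add: ennreal_less_iff)
  ultimately show ?thesis using U that by blast
qed

text \<open>
  The exceptional null set is covered by a small open set \<open>U\<close>. Splitting \<open>[a, b]\<close> into short
  intervals, the increment of \<open>f\<close> is at most \<open>\<epsilon>\<close> times the length on those with a good tag,
  and the others lie in \<open>U\<close>, where absolute continuity applies.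
\<close>

lemma abs_continuous_on_AE_deriv_nonpos:
  fixes f :: "real \<Rightarrow> real"
  assumes "a \<le> b" and ac: "abs_continuous_on a b f"
    and deriv: "AE t in lebesgue. a < t \<and> t < b \<longrightarrow> (\<exists>D\<le>0. (f has_real_derivative D) (at t))"
  shows "f b \<le> f a"
proof (rule field_le_epsilon)
  fix e0 :: real assume "e0 > 0"
  \<comment> \<open>Chosen so that e (b - a) \<le> e0/2; the added 1 keeps the denominator positive
    when \<open>a = b\<close>.\<close>
  define e where "e = e0 / (2 * (b - a + 1))"
  have "e > 0" using \<open>e0 > 0\<close> \<open>a \<le> b\<close> by (simp add: e_def)
  obtain N0 where N0: "N0 \<in> null_sets lebesgue"
    and N0_deriv: "\<And>t. a < t \<Longrightarrow> t < b \<Longrightarrow> t \<notin> N0 \<Longrightarrow> \<exists>D\<le>0. (f has_real_derivative D) (at t)"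
    using deriv by (auto elim!: AE_E3)
  \<comment> \<open>The derivative is only known inside the interval, so the endpoints are counted
    as exceptional.\<close>
  define N where "N = N0 \<union> {a, b}"
  have "{a, b} \<in> null_sets lebesgue"
    by (simp add: negligible_iff_null_sets[symmetric])
  then have N: "N \<in> null_sets lebesgue" using N0 by (auto simp: N_def)
  obtain d where d: "d > 0" "\<And>I. interval_family a b I \<Longrightarrow>
      (\<Sum>(r, s)\<in>I. s - r) < d \<Longrightarrow> (\<Sum>(r, s)\<in>I. norm (f s - f r)) < e0 / 2"
    by (rule abs_continuous_onE[OF ac half_gt_zero[OF \<open>e0 > 0\<close>]]) blast
  obtain U where U: "open U" "N \<subseteq> U" "U \<in> lmeasurable" "measure lebesgue U < d"
    by (rule negligible_open_cover[OF N d(1)]) blast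
  \<comment> \<open>An interval-additive property suited to bisection. It is conditional on lying in
    [a, b], because the local step also meets intervals that stick out.\<close>
  define P where "P u v \<longleftrightarrow> (a \<le> u \<and> v \<le> b \<longrightarrow> (\<exists>I. interval_family u v I \<and>
      (\<forall>(r, s)\<in>I. r < s \<and> {r<..<s} \<subseteq> U) \<and>
      f v - f u \<le> e * (v - u) + (\<Sum>(r, s)\<in>I. norm (f s - f r))))" for u v
  have "P a b"
  proof (rule Bolzano[OF \<open>a \<le> b\<close>, of P])
    fix u v w assume trans: "P u v" "P v w" "u \<le> v" "v \<le> w"
    show "P u w"
      unfolding P_def
    proof
      assume ends: "a \<le> u \<and> w \<le> b"
      then have "v \<le> b" "a \<le> v" using trans(3,4) by auto
      with trans(1) ends obtain I where I: "interval_family u v I"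
        "\<forall>(r, s)\<in>I. r < s \<and> {r<..<s} \<subseteq> U"
        "f v - f u \<le> e * (v - u) + (\<Sum>(r, s)\<in>I. norm (f s - f r))"
        unfolding P_def by blast
      from \<open>a \<le> v\<close> trans(2) ends obtain J where J: "interval_family v w J"
        "\<forall>(r, s)\<in>J. r < s \<and> {r<..<s} \<subseteq> U"
        "f w - f v \<le> e * (w - v) + (\<Sum>(r, s)\<in>J. norm (f s - f r))"
        unfolding P_def by blast
      \<comment> \<open>Strictness of r < s in \<open>P\<close> keeps a degenerate pair (v, v) out
        of both families, so they are disjoint as sets and the sum over the union splits.\<close>
      have "fst p < snd p \<and> snd p \<le> v" if "p \<in> I" for p
        using I(1,2) that by (auto simp: interval_family_def)
      moreover have "v \<le> fst p" if "p \<in> J" for p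
        using J(1) that by (auto simp: interval_family_def)
      ultimately have "I \<inter> J = {}" by force
      with I(1,3) J(1,3) have "f w - f u \<le> e * (w - u) + (\<Sum>(r, s)\<in>I \<union> J. norm (f s - f r))"
        by (simp add: sum.union_disjoint algebra_simps interval_family_def)
      moreover have "interval_family u w (I \<union> J)"
        using I(1) J(1) trans(3,4) by (rule interval_family_Un)
      moreover have "\<forall>(r, s)\<in>I \<union> J. r < s \<and> {r<..<s} \<subseteq> U"
        using I(2) J(2) by blast
      ultimately show "\<exists>I. interval_family u w I \<and> (\<forall>(r, s)\<in>I. r < s \<and> {r<..<s} \<subseteq> U) \<and>
          f w - f u \<le> e * (w - u) + (\<Sum>(r, s)\<in>I. norm (f s - f r))"
        by blast
    qed
  next
    fix x assume local: "a \<le> x" "x \<le> b"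
    show "\<exists>d>0. \<forall>u v. u \<le> x \<and> x \<le> v \<and> v - u < d \<longrightarrow> P u v"
    proof (cases "x \<in> N")
      case True
      then obtain k where k: "k > 0" "ball x k \<subseteq> U" using U by (meson open_contains_ball subsetD)
      have "P u v" if "u \<le> x" "x \<le> v" "v - u < k" for u v
      proof (cases "u = v")
        case False
        have "{u<..<v} \<subseteq> ball x k" using that by (auto simp: dist_real_def)
        with k False that have "{u<..<v} \<subseteq> U" "u < v" by auto
        moreover have "f v - f u \<le> e * (v - u) + norm (f v - f u)"
          using \<open>e > 0\<close> \<open>u < v\<close> by (smt (verit) mult_nonneg_nonneg real_norm_def)
        ultimately show ?thesis
          unfolding P_def by (intro impI exI[of _ "{(u, v)}"]) (auto simp: interval_family_def)
      qed (auto simp: P_def interval_family_def intro!: exI[of _ "{}"])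
      with k(1) show ?thesis by blast
    next
      case False
      with local have "a < x" "x < b" "x \<notin> N0" by (auto simp: N_def order_le_less)
      then obtain D where D: "D \<le> 0" "(f has_real_derivative D) (at x)" using N0_deriv by blast
      then obtain k where k: "k > 0" "\<And>y. norm (y - x) < k \<Longrightarrow> norm (f y - f x - D * (y - x)) \<le> e * norm (y - x)"
        using \<open>e > 0\<close> unfolding has_field_derivative_def has_derivative_at_alt by blast
      have "P u v" if uv: "u \<le> x" "x \<le> v" "v - u < k" for u v
      proof -
        have "norm (f u - f x - D * (u - x)) \<le> e * (x - u)" "norm (f v - f x - D * (v - x)) \<le> e * (v - x)"
          using k(2)[of u] k(2)[of v] uv by auto
        then have "f v - f u \<le> e * (v - u) + D * (v - u)"
          by (auto simp: algebra_simps abs_le_iff)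
        moreover have "D * (v - u) \<le> 0" using D(1) uv by (simp add: mult_le_0_iff)
        ultimately show ?thesis unfolding P_def by (intro impI exI[of _ "{}"]) (auto simp: interval_family_def)
      qed
      with k(1) show ?thesis by blast
    qed
  qed
  then obtain I where I: "interval_family a b I" "\<forall>(r, s)\<in>I. r < s \<and> {r<..<s} \<subseteq> U"
    "f b - f a \<le> e * (b - a) + (\<Sum>(r, s)\<in>I. norm (f s - f r))"
    by (auto simp: P_def)
  have "finite I" using I(1) by (simp add: interval_family_def)
  \<comment> \<open>The total length is the measure of a disjoint union inside \<open>U\<close>,
    hence below the threshold of absolute continuity.\<close>
  have "(\<Sum>(r, s)\<in>I. s - r) = (\<Sum>p\<in>I. measure lebesgue {fst p<..<snd p})"
    using I(2) by (intro sum.cong) auto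
  also have "\<dots> = measure lebesgue (\<Union>p\<in>I. {fst p<..<snd p})"
    using I(1) by (subst measure_finite_Union)
      (auto simp: interval_family_def disjoint_family_on_def pairwise_def case_prod_unfold)
  also have "\<dots> \<le> measure lebesgue U"
    using \<open>finite I\<close> I(2) U(3) by (intro measure_mono_fmeasurable) (auto simp: case_prod_unfold)
  also have "\<dots> < d" by (rule U)
  finally have "(\<Sum>(r, s)\<in>I. norm (f s - f r)) < e0 / 2"
    by (rule d(2)[OF I(1)])
  moreover have "e * (b - a) \<le> e0 / 2"
    using \<open>e0 > 0\<close> \<open>a \<le> b\<close> by (simp add: e_def field_simps)
  ultimately show "f b \<le> f a + e0" using I(3) by argo
qed

text \<open>Barrier argument: after the last time \<open>s\<close> at which \<open>f\<close> is at
  most the claimed maximum, \<open>f\<close> stays above \<open>B\<close> and is therefore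
  nonincreasing up to \<open>b\<close>.\<close>

lemma abs_continuous_on_AE_deriv_bound:
  fixes f :: "real \<Rightarrow> real"
  assumes "a \<le> b" and ac: "abs_continuous_on a b f"
    and deriv: "AE t in lebesgue. a < t \<and> t < b \<and> B \<le> f t \<longrightarrow> (\<exists>D\<le>0. (f has_real_derivative D) (at t))"
  shows "f b \<le> max (f a) B"
proof -
  define K where "K = max (f a) B"
  define S where "S = {t \<in> {a..b}. f t \<le> K}"
  have "closed S"
    unfolding S_def
    by (rule continuous_on_closed_Collect_le[OF abs_continuous_on_imp_continuous_on[OF ac]]) auto
  moreover have "bounded S" by (rule bounded_subset[of "{a..b}"]) (auto simp: S_def)
  moreover have "a \<in> S" using \<open>a \<le> b\<close> by (simp add: S_def K_def)
  ultimately have "compact S" "S \<noteq> {}" by (auto simp: compact_eq_bounded_closed)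
  then obtain s where s: "s \<in> S" "\<And>t. t \<in> S \<Longrightarrow> t \<le> s"
    using compact_attains_sup[OF \<open>compact S\<close> \<open>S \<noteq> {}\<close>] by blast
  then have "a \<le> s" "s \<le> b" "f s \<le> K" by (auto simp: S_def)
  have "B \<le> f t" if "s < t" "t < b" for t
    using s(2)[of t] that \<open>a \<le> s\<close> by (fastforce simp: S_def K_def)
  then have "AE t in lebesgue. s < t \<and> t < b \<longrightarrow> (\<exists>D\<le>0. (f has_real_derivative D) (at t))"
    using \<open>a \<le> s\<close> by (intro eventually_mono[OF deriv]) auto
  moreover have "abs_continuous_on s b f"
    using ac \<open>a \<le> s\<close> by (rule abs_continuous_on_subset) simp
  ultimately have "f b \<le> f s" using \<open>s \<le> b\<close> using abs_continuous_on_AE_deriv_nonpos by blast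
  with \<open>f s \<le> K\<close> show ?thesis by (simp add: K_def)
qed

section \<open>Decay along trajectories\<close>

text \<open>Pointwise dissipation of the energy: \<open>R\<close> stands for
  \<open>t powr (q / 2)\<close>, \<open>n\<close> for the norm of the state and \<open>z - y\<close>
  for the velocity. Since F = (\<delta>/R) y, the damping and the term F add up to (\<delta>/R) z,
  whence the form of \<open>h'\<close>. The left-hand side is the time derivative of \<delta>|y|^2/2
  + b|z|^2/2.\<close>

lemma energy_rate:
  fixes F' y z h' y' :: "'a::real_inner" and R t \<delta> \<gamma> q X n :: real
  defines "b \<equiv> \<gamma> * \<delta> / (\<delta> - \<gamma>)"
  defines "Q \<equiv> (norm y)\<^sup>2 + (norm z)\<^sup>2"
  assumes pos: "R > 0" "t > 0" "\<gamma> > 0" "\<gamma> < \<delta>" "0 < q" "q < 1" "0 \<le> n"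
    and mono: "(1 / R\<^sup>2) * (norm (z - y))\<^sup>2 - q / (R\<^sup>2 * t) * (n * norm (z - y)) \<le> F' \<bullet> (z - y)"
    and n_le: "n \<le> R * \<delta> * norm y + X"
    and y': "y' = (R / \<delta>) *\<^sub>R F' + (q / (2 * t)) *\<^sub>R y"
    and h': "h' = - ((\<delta> / R) *\<^sub>R z) - (R / \<gamma>) *\<^sub>R F'"
  shows "\<delta> * (y \<bullet> y') + b * (z \<bullet> (h' + y'))
    \<le> - (min 1 (b * \<delta>) / (4 * R)) * Q + R * \<delta>\<^sup>2 / t\<^sup>2 * Q + X\<^sup>2 / (R * t\<^sup>2) + (\<delta> + b) / (2 * t) * Q"
proof -
  \<comment> \<open>The bounds \<kappa> \<le> 1 and \<kappa> \<le> b \<delta> allow the dissipation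
    in z - y and in z, respectively, to be compared with one multiple of \<open>Q\<close>.\<close>
  define \<kappa> where "\<kappa> = min 1 (b * \<delta>)"
  have "\<delta> > 0" using pos by linarith
  have "b > 0" using pos \<open>\<delta> > 0\<close> by (simp add: b_def)
  then have \<kappa>: "0 < \<kappa>" "\<kappa> \<le> 1" "\<kappa> \<le> b * \<delta>" using \<open>\<delta> > 0\<close> by (auto simp: \<kappa>_def)
  \<comment> \<open>This identity dictates \<open>b\<close>: the products of F' with y and with z
    merge into -R times its product with the velocity z - y.\<close>
  have b_eq: "b * (R / \<delta> - R / \<gamma>) = - R"
    using pos \<open>\<delta> > 0\<close> by (simp add: b_def divide_simps) (simp add: algebra_simps)
  have "y \<bullet> y' = (R / \<delta>) * (y \<bullet> F') + q / (2 * t) * (y \<bullet> y)"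
    by (simp add: y' inner_add_right)
  then have "\<delta> * (y \<bullet> y') = R * (y \<bullet> F') + \<delta> * (q / (2 * t)) * (norm y)\<^sup>2"
    using \<open>\<delta> > 0\<close> by (simp add: distrib_left power2_norm_eq_inner)
  moreover have "z \<bullet> (h' + y') = - (\<delta> / R) * (z \<bullet> z) + (R / \<delta> - R / \<gamma>) * (z \<bullet> F') + q / (2 * t) * (z \<bullet> y)"
    by (simp add: y' h' inner_add_right inner_diff_right algebra_simps)
  then have "b * (z \<bullet> (h' + y')) = - (b * \<delta> / R) * (norm z)\<^sup>2
      + (b * (R / \<delta> - R / \<gamma>)) * (z \<bullet> F') + b * (q / (2 * t)) * (z \<bullet> y)"
    by (simp add: distrib_left right_diff_distrib power2_norm_eq_inner mult.assoc)
  ultimately have eq: "\<delta> * (y \<bullet> y') + b * (z \<bullet> (h' + y')) = - R * (F' \<bullet> (z - y))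
      - (b * \<delta> / R) * (norm z)\<^sup>2 + (q / (2 * t)) * (\<delta> * (norm y)\<^sup>2 + b * (z \<bullet> y))"
    unfolding b_eq by (simp add: inner_diff_right inner_commute algebra_simps)
  define H where "H = norm (z - y)"
  \<comment> \<open>Young's inequality spends half of the damping on the product (n/t) H; the
    remaining n^2 is estimated through \<open>n_le\<close>.\<close>
  have damp: "- R * (F' \<bullet> (z - y)) \<le> - (1 / (2 * R)) * H\<^sup>2 + R * \<delta>\<^sup>2 / t\<^sup>2 * (norm y)\<^sup>2 + X\<^sup>2 / (R * t\<^sup>2)"
  proof -
    have "R * ((1 / R\<^sup>2) * H\<^sup>2 - q / (R\<^sup>2 * t) * (n * H)) \<le> R * (F' \<bullet> (z - y))"
      using mono pos by (intro mult_left_mono) (auto simp: H_def)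
    moreover have "R * ((1 / R\<^sup>2) * H\<^sup>2 - q / (R\<^sup>2 * t) * (n * H)) = (1 / R) * H\<^sup>2 - (1 / R) * (q * ((n / t) * H))"
      using pos by (simp add: field_simps power2_eq_square)
    ultimately have 1: "- R * (F' \<bullet> (z - y)) \<le> - (1 / R) * H\<^sup>2 + (1 / R) * (q * ((n / t) * H))"
      by simp
    have "q * ((n / t) * H) \<le> 1 * ((n / t) * H)"
      using pos by (intro mult_right_mono) (auto simp: H_def)
    also have "\<dots> \<le> ((n / t)\<^sup>2 + H\<^sup>2) / 2"
      using sum_squares_bound[of "n / t" H] by (simp add: mult_ac)
    finally have "(1 / R) * (q * ((n / t) * H)) \<le> (1 / R) * (((n / t)\<^sup>2 + H\<^sup>2) / 2)"
      using pos by (intro mult_left_mono) auto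
    also have "\<dots> = (1 / (2 * R * t\<^sup>2)) * n\<^sup>2 + (1 / R) * H\<^sup>2 / 2"
      using pos by (simp add: field_simps power2_eq_square)
    finally have 2: "- R * (F' \<bullet> (z - y)) \<le> - (1 / (2 * R)) * H\<^sup>2 + (1 / (2 * R * t\<^sup>2)) * n\<^sup>2"
      using 1 by simp
    have "n\<^sup>2 \<le> (R * \<delta> * norm y + X)\<^sup>2" using n_le pos by (intro power_mono) auto
    also have "\<dots> \<le> 2 * (R * \<delta> * norm y)\<^sup>2 + 2 * X\<^sup>2"
      using sum_squares_bound[of "R * \<delta> * norm y" X] by (simp add: power2_sum)
    finally have "(1 / (2 * R * t\<^sup>2)) * n\<^sup>2 \<le> (1 / (2 * R * t\<^sup>2)) * (2 * (R * \<delta> * norm y)\<^sup>2 + 2 * X\<^sup>2)"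
      using pos by (intro mult_left_mono) auto
    also have "\<dots> = R * \<delta>\<^sup>2 / t\<^sup>2 * (norm y)\<^sup>2 + X\<^sup>2 / (R * t\<^sup>2)"
      using pos by (simp add: field_simps power2_eq_square)
    finally show ?thesis using 2 by linarith
  qed
  have "0 \<le> b * \<delta> * (norm z)\<^sup>2" using \<open>b > 0\<close> \<open>\<delta> > 0\<close> by simp
  \<comment> \<open>Only z and z - y are damped directly; the triangle inequality recovers control
    of y.\<close>
  have "norm y \<le> norm z + H"
    using norm_triangle_ineq4[of z "z - y"] by (simp add: H_def)
  then have "(norm y)\<^sup>2 \<le> (norm z + H)\<^sup>2" by (intro power_mono) auto
  also have "\<dots> \<le> 2 * (norm z)\<^sup>2 + 2 * H\<^sup>2"
    using sum_squares_bound[of "norm z" H] by (simp add: power2_sum)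
  finally have "\<kappa> * ((norm y)\<^sup>2 / 2 - (norm z)\<^sup>2) \<le> \<kappa> * H\<^sup>2"
    using \<kappa> by (intro mult_left_mono) auto
  also have "\<dots> \<le> H\<^sup>2" using \<kappa> by (intro mult_left_le_one_le) auto
  finally have "\<kappa> / 4 * Q \<le> H\<^sup>2 / 2 + (3/4) * (\<kappa> * (norm z)\<^sup>2)"
    by (simp add: Q_def algebra_simps)
  also have "\<kappa> * (norm z)\<^sup>2 \<le> b * \<delta> * (norm z)\<^sup>2"
    using \<kappa> by (intro mult_right_mono) auto
  finally have "\<kappa> / 4 * Q \<le> H\<^sup>2 / 2 + b * \<delta> * (norm z)\<^sup>2"
    using \<open>0 \<le> b * \<delta> * (norm z)\<^sup>2\<close> by linarith
  then have "(1 / R) * (\<kappa> / 4 * Q) \<le> (1 / R) * (H\<^sup>2 / 2 + b * \<delta> * (norm z)\<^sup>2)"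
    using pos by (intro mult_left_mono) auto
  also have "\<dots> = (1 / (2 * R)) * H\<^sup>2 + (b * \<delta> / R) * (norm z)\<^sup>2" by (simp add: distrib_left)
  finally have dissip: "- (1 / (2 * R)) * H\<^sup>2 - (b * \<delta> / R) * (norm z)\<^sup>2 \<le> - (\<kappa> / (4 * R)) * Q"
    by simp
  have "z \<bullet> y \<le> norm z * norm y" by (rule norm_cauchy_schwarz)
  also have "\<dots> \<le> Q" using sum_squares_bound[of "norm z" "norm y"] mult_nonneg_nonneg[OF norm_ge_zero norm_ge_zero, of z y]
    unfolding Q_def by linarith
  finally have "b * (z \<bullet> y) \<le> b * Q" using \<open>b > 0\<close> by simp
  moreover have "\<delta> * (norm y)\<^sup>2 \<le> \<delta> * Q" using \<open>\<delta> > 0\<close> by (simp add: Q_def)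
  ultimately have "\<delta> * (norm y)\<^sup>2 + b * (z \<bullet> y) \<le> (\<delta> + b) * Q" by (simp add: distrib_right)
  moreover have "0 \<le> Q" by (simp add: Q_def)
  then have "0 \<le> (\<delta> + b) * Q" using \<open>b > 0\<close> \<open>\<delta> > 0\<close> by simp
  moreover have "q / (2 * t) \<le> 1 / (2 * t)" using pos by (intro divide_right_mono) auto
  ultimately have "(q / (2 * t)) * (\<delta> * (norm y)\<^sup>2 + b * (z \<bullet> y)) \<le> (1 / (2 * t)) * ((\<delta> + b) * Q)"
    using pos by (intro order_trans[OF mult_left_mono mult_right_mono]) auto
  moreover have "R * \<delta>\<^sup>2 / t\<^sup>2 * (norm y)\<^sup>2 \<le> R * \<delta>\<^sup>2 / t\<^sup>2 * Q"
    using pos by (intro mult_left_mono) (auto simp: Q_def)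
  ultimately show ?thesis
    using eq damp dissip by (simp add: \<kappa>_def)
qed

text \<open>Here \<open>F\<close> is the regularized operator along the trajectory and
  \<open>h\<close> the velocity; monotonicity enters through the inequality in \<open>ode\<close>.
  Beyond a suitable time, the weighted energy \<open>W\<close> has nonpositive derivative wherever
  it is at least \<open>B\<close>, so the barrier lemma bounds it.\<close>

lemma velocity_decay:
  fixes F h x :: "real \<Rightarrow> 'a::real_inner" and \<delta> \<gamma> q t\<^sub>0 X :: real
  assumes pos: "\<gamma> > 0" "\<gamma> < \<delta>" "0 < q" "q < 1" "t\<^sub>0 > 0"
    and ac: "locally_abs_continuous t\<^sub>0 F" "locally_abs_continuous t\<^sub>0 h"
    and ode: "AE t in lebesgue. t > t\<^sub>0 \<longrightarrow> (\<exists>F' h'.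
        (F has_vector_derivative F') (at t) \<and> (h has_vector_derivative h') (at t) \<and>
        h' + (\<delta> / t powr (q / 2)) *\<^sub>R h t + ((1 / \<gamma>) * t powr (q / 2)) *\<^sub>R F' + F t = 0 \<and>
        1 / t powr q * (norm (h t))\<^sup>2 - q / (t powr q * t) * (norm (x t) * norm (h t)) \<le> F' \<bullet> h t)"
    and x_le: "\<And>t. t \<ge> t\<^sub>0 \<Longrightarrow> norm (x t) \<le> t powr q * norm (F t) + X"
  obtains C where "eventually (\<lambda>t. (norm (F t))\<^sup>2 \<le> C * t powr (- q - 2)) at_top"
    and "eventually (\<lambda>t. (norm (h t))\<^sup>2 \<le> C * t powr (- 2)) at_top"
proof -
  define b where "b = \<gamma> * \<delta> / (\<delta> - \<gamma>)"
  define \<kappa> where "\<kappa> = min 1 (b * \<delta>)"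
  have "\<delta> > 0" using pos by linarith
  have "b > 0" using pos \<open>\<delta> > 0\<close> by (simp add: b_def)
  then have "\<kappa> > 0" using \<open>\<delta> > 0\<close> by (simp add: \<kappa>_def)
  define R where "R t = t powr (q / 2)" for t :: real
  define y where "y t = (1 / \<delta>) *\<^sub>R (R t *\<^sub>R F t)" for t
  define z where "z t = h t + y t" for t
  define W where "W t = t * t * ((\<delta> / 2) * (y t \<bullet> y t) + (b / 2) * (z t \<bullet> z t))" for t
  \<comment> \<open>By V \<le> (\<delta> + b) Q/2, the inequality t^2 V \<ge> B forces \<kappa> t^2
    Q/8 \<ge> X^2, so damping beats the constant term.\<close>
  define B where "B = 4 * (\<delta> + b) * X\<^sup>2 / \<kappa>"
  have "((\<lambda>t. t powr (q / 2 - 1)) \<longlongrightarrow> 0) at_top"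
    using pos by (intro tendsto_neg_powr filterlim_ident) auto
  moreover have "eventually (\<lambda>t. t powr (q / 2 - 1) = R t / t) at_top"
    using eventually_gt_at_top[of 0] by eventually_elim (simp add: R_def powr_diff)
  ultimately have R_lim: "((\<lambda>t. R t / t) \<longlongrightarrow> 0) at_top"
    by (rule Lim_transform_eventually)
  \<comment> \<open>These are the error terms left once 1/R is factored out; eventually they cost at
    most half of the damping \<kappa>/4. The factor 3/2 collects 1 from differentiating t^2 and 1/2
    from \<open>energy_rate\<close>.\<close>
  have "((\<lambda>t. \<delta>\<^sup>2 * (R t / t)\<^sup>2 + 3 / 2 * (\<delta> + b) * (R t / t)) \<longlongrightarrow> \<delta>\<^sup>2 * 0\<^sup>2 + 3 / 2 * (\<delta> + b) * 0) at_top"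
    by (intro tendsto_intros R_lim)
  then have "eventually (\<lambda>t. \<delta>\<^sup>2 * (R t / t)\<^sup>2 + 3 / 2 * (\<delta> + b) * (R t / t) < \<kappa> / 8) at_top"
    using \<open>\<kappa> > 0\<close> by (intro order_tendstoD(2)) auto
  then obtain T0 where T0: "\<And>t. t \<ge> T0 \<Longrightarrow> \<delta>\<^sup>2 * (R t / t)\<^sup>2 + 3 / 2 * (\<delta> + b) * (R t / t) < \<kappa> / 8"
    by (auto simp: eventually_at_top_linorder)
  define T where "T = max t\<^sub>0 T0"
  have "T > 0" "T \<ge> t\<^sub>0" "T \<ge> T0" using pos by (auto simp: T_def)
  have W_bound: "W t \<le> max (W T) B" if "t > T" for t
  proof (rule abs_continuous_on_AE_deriv_bound[where f = W and a = T and b = t])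
    show "T \<le> t" using that by simp
    have acF: "abs_continuous_on T t F" and ach: "abs_continuous_on T t h"
      using ac that \<open>T \<ge> t\<^sub>0\<close> unfolding locally_abs_continuous_def
      by (meson abs_continuous_on_subset order_refl order_le_less_trans)+
    have acy: "abs_continuous_on T t y"
      unfolding y_def R_def using \<open>T > 0\<close>
      by (intro abs_continuous_on_scaleR abs_continuous_on_const abs_continuous_on_powr acF)
    have "abs_continuous_on T t z"
      unfolding z_def by (intro abs_continuous_on_add ach acy)
    then show "abs_continuous_on T t W"
      unfolding W_def using acy
      by (intro abs_continuous_on_mult abs_continuous_on_id abs_continuous_on_add
          abs_continuous_on_const abs_continuous_on_inner)
    show "AE u in lebesgue. T < u \<and> u < t \<and> B \<le> W u \<longrightarrow> (\<exists>D\<le>0. (W has_real_derivative D) (at u))"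
      using ode
    proof eventually_elim
      case (elim u)
      show ?case
      proof
        assume u: "T < u \<and> u < t \<and> B \<le> W u"
        then have "u > t\<^sub>0" "u > 0" using \<open>T \<ge> t\<^sub>0\<close> \<open>T > 0\<close> by auto
        have "R u > 0" and R2: "u powr q = (R u)\<^sup>2"
          using \<open>u > 0\<close> by (auto simp: R_def power2_eq_square simp flip: powr_add)
        obtain F' h' where F': "(F has_vector_derivative F') (at u)"
          and h': "(h has_vector_derivative h') (at u)"
          and eq: "h' + (\<delta> / R u) *\<^sub>R h u + ((1 / \<gamma>) * R u) *\<^sub>R F' + F u = 0"
          and mono: "1 / (R u)\<^sup>2 * (norm (h u))\<^sup>2 - q / ((R u)\<^sup>2 * u) * (norm (x u) * norm (h u)) \<le> F' \<bullet> h u"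
          using elim \<open>u > t\<^sub>0\<close> unfolding R2 R_def[symmetric] by blast
        have F_eq: "F u = (\<delta> / R u) *\<^sub>R y u"
          using \<open>R u > 0\<close> \<open>\<delta> > 0\<close> by (simp add: y_def)
        have R': "(R has_real_derivative (q / (2 * u)) * R u) (at u)"
          unfolding R_def using \<open>u > 0\<close>
          by (auto intro!: derivative_eq_intros simp: powr_diff)
        define y' where "y' = (R u / \<delta>) *\<^sub>R F' + (q / (2 * u)) *\<^sub>R y u"
        have y': "(y has_vector_derivative y') (at u)"
          unfolding y_def y'_def
          using bounded_linear.has_vector_derivative[OF bounded_linear_scaleR_right
              has_vector_derivative_scaleR[OF R' F'], of "1 / \<delta>"]
          by (simp add: scaleR_add_right mult.commute)
        have z': "(z has_vector_derivative h' + y') (at u)"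
          unfolding z_def by (intro derivative_intros h' y')
        define V where "V = (\<delta> / 2) * (y u \<bullet> y u) + (b / 2) * (z u \<bullet> z u)"
        define D where "D = 2 * u * V + u * u * (\<delta> * (y u \<bullet> y') + b * (z u \<bullet> (h' + y')))"
        have inner_deriv: "((\<lambda>t. g t \<bullet> g t) has_real_derivative 2 * (g u \<bullet> g')) (at u)"
          if "(g has_vector_derivative g') (at u)" for g :: "real \<Rightarrow> 'a" and g'
          using bounded_bilinear.has_vector_derivative[OF bounded_bilinear_inner that that]
          by (simp add: has_real_derivative_iff_has_vector_derivative inner_commute)
        have W': "(W has_real_derivative D) (at u)"
          unfolding W_def D_def V_def
          by (auto intro!: derivative_eq_intros inner_deriv[OF y'] inner_deriv[OF z'] simp: field_simps)
        define Q where "Q = (norm (y u))\<^sup>2 + (norm (z u))\<^sup>2"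
        have "Q \<ge> 0" by (simp add: Q_def)
        have h_eq: "h u = z u - y u" by (simp add: z_def)
        have rate: "\<delta> * (y u \<bullet> y') + b * (z u \<bullet> (h' + y')) \<le> - (\<kappa> / (4 * R u)) * Q
            + R u * \<delta>\<^sup>2 / u\<^sup>2 * Q + X\<^sup>2 / (R u * u\<^sup>2) + (\<delta> + b) / (2 * u) * Q"
          unfolding \<kappa>_def Q_def b_def
        proof (rule energy_rate[OF \<open>R u > 0\<close> \<open>u > 0\<close> pos(1-4) _ _ _ y'_def])
          show "1 / (R u)\<^sup>2 * (norm (z u - y u))\<^sup>2 - q / ((R u)\<^sup>2 * u) * (norm (x u) * norm (z u - y u))
              \<le> F' \<bullet> (z u - y u)"
            using mono by (simp add: h_eq)
          have "norm (F u) = \<delta> / R u * norm (y u)"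
            using \<open>R u > 0\<close> \<open>\<delta> > 0\<close> by (simp add: F_eq)
          then show "norm (x u) \<le> R u * \<delta> * norm (y u) + X"
            using x_le[of u] \<open>u > t\<^sub>0\<close> \<open>R u > 0\<close> by (simp add: R2 power2_eq_square)
          show "h' = - ((\<delta> / R u) *\<^sub>R z u) - (R u / \<gamma>) *\<^sub>R F'"
            using eq by (simp add: F_eq h_eq algebra_simps eq_neg_iff_add_eq_0)
        qed auto
        have V_le: "V \<le> (\<delta> + b) / 2 * Q"
        proof -
          have "(\<delta> / 2) * (norm (y u))\<^sup>2 \<le> (\<delta> + b) / 2 * (norm (y u))\<^sup>2"
            "(b / 2) * (norm (z u))\<^sup>2 \<le> (\<delta> + b) / 2 * (norm (z u))\<^sup>2"
            using \<open>b > 0\<close> \<open>\<delta> > 0\<close> by (intro mult_right_mono; simp)+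
          then show ?thesis by (simp add: V_def Q_def power2_norm_eq_inner distrib_left)
        qed
        have "D \<le> u * u * ((\<delta> + b) / u * Q) + u * u * (- (\<kappa> / (4 * R u)) * Q
            + R u * \<delta>\<^sup>2 / u\<^sup>2 * Q + X\<^sup>2 / (R u * u\<^sup>2) + (\<delta> + b) / (2 * u) * Q)"
          unfolding D_def
        proof (rule add_mono[OF _ mult_left_mono[OF rate]])
          have "2 * u * V \<le> 2 * u * ((\<delta> + b) / 2 * Q)"
            using V_le \<open>u > 0\<close> by (intro mult_left_mono) auto
          then show "2 * u * V \<le> u * u * ((\<delta> + b) / u * Q)" using \<open>u > 0\<close> by simp
        qed simp
        also have "\<dots> = (1 / R u) * (u\<^sup>2 * Q * (\<delta>\<^sup>2 * (R u / u)\<^sup>2 + 3 / 2 * (\<delta> + b) * (R u / u) - \<kappa> / 4) + X\<^sup>2)"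
          using \<open>u > 0\<close> \<open>R u > 0\<close> by (simp add: field_simps power2_eq_square)
        also have "\<dots> \<le> (1 / R u) * (u\<^sup>2 * Q * (- \<kappa> / 8) + X\<^sup>2)"
        proof -
          have "\<delta>\<^sup>2 * (R u / u)\<^sup>2 + 3 / 2 * (\<delta> + b) * (R u / u) - \<kappa> / 4 \<le> - \<kappa> / 8"
            using T0[of u] u \<open>T \<ge> T0\<close> by linarith
          then show ?thesis
            using \<open>R u > 0\<close> \<open>Q \<ge> 0\<close> by (intro mult_left_mono add_right_mono) auto
        qed
        also have "\<dots> \<le> 0"
        proof -
          have "B \<le> u\<^sup>2 * V" using u by (simp add: W_def V_def power2_eq_square)
          also have "\<dots> \<le> u\<^sup>2 * ((\<delta> + b) / 2 * Q)" by (intro mult_left_mono V_le) auto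
          finally have "B \<le> u\<^sup>2 * ((\<delta> + b) / 2 * Q)" .
          then have "(\<delta> + b) * (8 * X\<^sup>2) \<le> (\<delta> + b) * (u\<^sup>2 * Q * \<kappa>)"
            using \<open>\<kappa> > 0\<close> by (simp add: B_def field_simps)
          moreover have "\<delta> + b > 0" using \<open>b > 0\<close> \<open>\<delta> > 0\<close> by simp
          ultimately have "8 * X\<^sup>2 \<le> u\<^sup>2 * Q * \<kappa>"
            by (simp only: mult_le_cancel_left_pos)
          then show ?thesis using \<open>R u > 0\<close> by (intro mult_nonneg_nonpos) auto
        qed
        finally show "\<exists>D\<le>0. (W has_real_derivative D) (at u)" using W' by blast
      qed
    qed
  qed
  define K where "K = max (W T) B"
  have est: "(norm (y t))\<^sup>2 \<le> 2 * K / \<delta> / t\<^sup>2" "(norm (z t))\<^sup>2 \<le> 2 * K / b / t\<^sup>2" if "t > T" for t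
  proof -
    have "t > 0" using that \<open>T > 0\<close> by simp
    have "t\<^sup>2 * ((\<delta> / 2) * (norm (y t))\<^sup>2 + (b / 2) * (norm (z t))\<^sup>2) \<le> K"
      using W_bound[OF that] by (simp only: W_def K_def power2_norm_eq_inner power2_eq_square[of t])
    then have "t\<^sup>2 * ((\<delta> / 2) * (norm (y t))\<^sup>2) + t\<^sup>2 * ((b / 2) * (norm (z t))\<^sup>2) \<le> K"
      by (simp add: distrib_left)
    moreover have "0 \<le> t\<^sup>2 * ((\<delta> / 2) * (norm (y t))\<^sup>2)" "0 \<le> t\<^sup>2 * ((b / 2) * (norm (z t))\<^sup>2)"
      using \<open>b > 0\<close> \<open>\<delta> > 0\<close> by auto
    ultimately have "t\<^sup>2 * ((\<delta> / 2) * (norm (y t))\<^sup>2) \<le> K" "t\<^sup>2 * ((b / 2) * (norm (z t))\<^sup>2) \<le> K"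
      by linarith+
    then show "(norm (y t))\<^sup>2 \<le> 2 * K / \<delta> / t\<^sup>2" "(norm (z t))\<^sup>2 \<le> 2 * K / b / t\<^sup>2"
      using \<open>t > 0\<close> \<open>b > 0\<close> \<open>\<delta> > 0\<close> by (simp_all add: field_simps)
  qed
  have powr2: "t powr (- 2) = 1 / t\<^sup>2" if "t > 0" for t :: real
    using that by (simp add: powr_minus_divide)
  \<comment> \<open>The first entry serves the bound on \<open>F\<close>, the second that on h = z -
    y.\<close>
  define C where "C = max (2 * K * \<delta>) (4 * K / \<delta> + 4 * K / b)"
  show ?thesis
  proof (rule that[of C])
    show "eventually (\<lambda>t. (norm (F t))\<^sup>2 \<le> C * t powr (- q - 2)) at_top"
      using eventually_gt_at_top[of T]
    proof eventually_elim
      case (elim t)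
      then have "t > 0" using \<open>T > 0\<close> by simp
      then have "R t > 0" and R2: "t powr q = (R t)\<^sup>2"
        by (auto simp: R_def power2_eq_square simp flip: powr_add)
      have "F t = (\<delta> / R t) *\<^sub>R y t"
        using \<open>R t > 0\<close> \<open>\<delta> > 0\<close> by (simp add: y_def)
      then have "(norm (F t))\<^sup>2 = \<delta>\<^sup>2 / (R t)\<^sup>2 * (norm (y t))\<^sup>2"
        by (simp add: power_mult_distrib power_divide)
      also have "\<dots> \<le> \<delta>\<^sup>2 / (R t)\<^sup>2 * (2 * K / \<delta> / t\<^sup>2)"
        using est(1)[OF elim] by (intro mult_left_mono) auto
      also have "\<dots> = 2 * K * \<delta> * t powr (- q - 2)"
        using \<open>t > 0\<close> \<open>\<delta> > 0\<close> \<open>R t > 0\<close>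
        by (simp add: powr_diff powr_minus_divide R2 power2_eq_square mult_ac)
      also have "\<dots> \<le> C * t powr (- q - 2)"
        by (intro mult_right_mono) (auto simp: C_def)
      finally show ?case .
    qed
    show "eventually (\<lambda>t. (norm (h t))\<^sup>2 \<le> C * t powr (- 2)) at_top"
      using eventually_gt_at_top[of T]
    proof eventually_elim
      case (elim t)
      then have "t > 0" using \<open>T > 0\<close> by simp
      have "norm (h t) \<le> norm (z t) + norm (y t)"
        using norm_triangle_ineq4[of "z t" "y t"] by (simp add: z_def)
      then have "(norm (h t))\<^sup>2 \<le> (norm (z t) + norm (y t))\<^sup>2" by (intro power_mono) auto
      also have "\<dots> \<le> 2 * (norm (z t))\<^sup>2 + 2 * (norm (y t))\<^sup>2"
        using sum_squares_bound[of "norm (z t)" "norm (y t)"] by (simp add: power2_sum)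
      also have "\<dots> \<le> 2 * (2 * K / b / t\<^sup>2) + 2 * (2 * K / \<delta> / t\<^sup>2)"
        using est[OF elim] by (intro add_mono mult_left_mono) auto
      also have "\<dots> = (4 * K / \<delta> + 4 * K / b) * t powr (- 2)"
        using \<open>t > 0\<close> by (simp add: powr2 add_divide_distrib)
      also have "\<dots> \<le> C * t powr (- 2)"
        by (intro mult_right_mono) (auto simp: C_def)
      finally show ?case .
    qed
  qed
qed

section \<open>Monotonicity along differentiable curves and comparison of powers\<close>

lemma has_vector_derivative_difference_quotient:
  assumes "(f has_vector_derivative f') (at t)"
  shows "((\<lambda>k. (f (t + k) - f t) /\<^sub>R k) \<longlongrightarrow> f') (at 0)"
proof -
  have "((\<lambda>k. norm (f (t + k) - f t - k *\<^sub>R f') / norm k) \<longlongrightarrow> 0) (at 0)"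
    using assms by (simp add: has_vector_derivative_def has_derivative_at)
  moreover have "eventually (\<lambda>k. norm (f (t + k) - f t - k *\<^sub>R f') / norm k
      = norm ((f (t + k) - f t) /\<^sub>R k - f')) (at 0)"
  proof (rule eventually_at_filter[THEN iffD2], intro always_eventually allI impI)
    fix k :: real assume "k \<noteq> 0"
    then have "(f (t + k) - f t) /\<^sub>R k - f' = (f (t + k) - f t - k *\<^sub>R f') /\<^sub>R k"
      by (simp add: scaleR_diff_right)
    then show "norm (f (t + k) - f t - k *\<^sub>R f') / norm k = norm ((f (t + k) - f t) /\<^sub>R k - f')"
      by (simp add: divide_inverse_commute)
  qed
  ultimately have "((\<lambda>k. norm ((f (t + k) - f t) /\<^sub>R k - f')) \<longlongrightarrow> 0) (at 0)"
    by (rule Lim_transform_eventually)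
  then show ?thesis by (simp add: tendsto_norm_zero_iff LIM_zero_iff)
qed

text \<open>The two difference quotients share the increment k, so their inner product carries the
  positive factor 1/k^2 whatever the sign of k. This applies to the trajectory and its image under
  \<open>M\<close>, where \<open>M\<close> itself is only known to be Lipschitz.\<close>

lemma monotone_derivative_inner:
  fixes f g :: "real \<Rightarrow> 'a::real_inner"
  assumes f: "(f has_vector_derivative f') (at t)" and g: "(g has_vector_derivative g') (at t)"
    and mono: "\<And>s. 0 \<le> (f s - f t) \<bullet> (g s - g t)"
  shows "0 \<le> f' \<bullet> g'"
proof (rule tendsto_lowerbound)
  show "((\<lambda>k. ((f (t + k) - f t) /\<^sub>R k) \<bullet> ((g (t + k) - g t) /\<^sub>R k)) \<longlongrightarrow> f' \<bullet> g') (at 0)"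
    by (intro tendsto_inner has_vector_derivative_difference_quotient f g)
  have "0 \<le> ((f (t + k) - f t) /\<^sub>R k) \<bullet> ((g (t + k) - g t) /\<^sub>R k)" for k
    unfolding inner_scaleR_left inner_scaleR_right mult.assoc[symmetric]
    by (intro mult_nonneg_nonneg zero_le_square mono)
  then show "\<forall>\<^sub>F k in at 0. 0 \<le> ((f (t + k) - f t) /\<^sub>R k) \<bullet> ((g (t + k) - g t) /\<^sub>R k)"
    by simp
qed simp

lemma deriv_from_works:
  assumes "f differentiable (at t within {t\<^sub>0..})" "t > t\<^sub>0"
  shows "(f has_vector_derivative deriv_from t\<^sub>0 f t) (at t)"
proof -
  have "at t within {t\<^sub>0..} = at t" using assms(2) by (intro at_within_interior) simp
  with assms(1) show ?thesis by (simp add: deriv_from_def vector_derivative_works)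
qed

lemma bigo_powrI:
  fixes f :: "real \<Rightarrow> real"
  assumes "eventually (\<lambda>t. 0 \<le> f t \<and> f t \<le> C * t powr a) at_top" "a \<le> b"
  shows "f \<in> O[at_top](\<lambda>t. t powr b)"
\<comment> \<open>The sign of \<open>C\<close> is unknown, hence the absolute value; for t \<ge> 1
  powers grow with the exponent.\<close>
proof (rule bigoI[where c = "\<bar>C\<bar>"])
  show "eventually (\<lambda>t. norm (f t) \<le> \<bar>C\<bar> * norm (t powr b)) at_top"
    using assms(1) eventually_ge_at_top[of 1]
  proof eventually_elim
    case (elim t)
    have "C * t powr a \<le> \<bar>C\<bar> * t powr b"
      using elim(2) assms(2) by (intro mult_mono powr_mono) auto
    with elim(1) show ?case by simp
  qed
qed

theorem theorem5p1:
  fixes A :: "'a::{real_inner, complete_space} \<Rightarrow> 'a set"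
    and x :: "real \<Rightarrow> 'a"
    and \<rho> \<eta> \<delta> \<gamma> q t\<^sub>0 :: real
    and \<epsilon> :: "real \<Rightarrow> real"
    and x\<epsilon> :: "real \<Rightarrow> 'a"
  defines "\<epsilon> \<equiv> \<lambda>t. 1 / t powr q"
    and "x\<epsilon> \<equiv> \<lambda>t. yosida_reg_zero \<eta> A (\<epsilon> t)"
  assumes "maximally_comonotone \<rho> A"
    and "zer A \<noteq> {}"
    and "\<eta> > max (- 2 * \<rho>) 0"
    and "\<delta> > 0" and "\<gamma> > 0"
    and "0 < q" and "q < 1"
    and "t\<^sub>0 > 0"
    and "strong_global_solution \<eta> A \<delta> \<gamma> q t\<^sub>0 x"
    and "\<gamma> < \<delta>" and "\<delta> < \<gamma> + \<gamma> / (1/2 * \<gamma>\<^sup>2 + 1)"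
  shows
    "(q < 2/3 \<longrightarrow>
        (\<lambda>t. (norm (x t - x\<epsilon> t))\<^sup>2) \<in> O[at_top](\<lambda>t. t powr (q/2 - 1)) \<and>
        (\<lambda>t. (norm (deriv_from t\<^sub>0 x t))\<^sup>2) \<in> O[at_top](\<lambda>t. t powr (- q/2 - 1)) \<and>
        (\<lambda>t. (norm (yosida \<eta> A (x t) + \<epsilon> t *\<^sub>R x\<epsilon> t))\<^sup>2) \<in> O[at_top](\<lambda>t. t powr (- q/2 - 1))) \<and>
     (2/3 \<le> q \<longrightarrow>
        (\<lambda>t. (norm (x t - x\<epsilon> t))\<^sup>2) \<in> O[at_top](\<lambda>t. t powr (2*q - 2)) \<and>
        (\<lambda>t. (norm (deriv_from t\<^sub>0 x t))\<^sup>2) \<in> O[at_top](\<lambda>t. t powr (q - 2)) \<and>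
        (\<lambda>t. (norm (yosida \<eta> A (x t) + \<epsilon> t *\<^sub>R x\<epsilon> t))\<^sup>2) \<in> O[at_top](\<lambda>t. t powr (q - 2)))"
proof -
  interpret yosida_regularization A \<rho> \<eta>
    using assms by unfold_locales
  obtain p where p: "M p = 0" using yosida_zero[OF assms(4)] by blast
  have e_pos: "1 / t powr q > 0" if "t > 0" for t :: real using that by simp
  define h where "h = deriv_from t\<^sub>0 x"
  define F where "F t = M (x t) + (1 / t powr q) *\<^sub>R x t" for t
  have x_diff: "\<And>t. t \<ge> t\<^sub>0 \<Longrightarrow> x differentiable (at t within {t\<^sub>0..})"
    and ac_x: "locally_abs_continuous t\<^sub>0 x" and ac_h: "locally_abs_continuous t\<^sub>0 h"
    and eqn: "AE t in lebesgue. t \<ge> t\<^sub>0 \<longrightarrow> h differentiable (at t within {t\<^sub>0..}) \<and>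
        F differentiable (at t within {t\<^sub>0..}) \<and>
        deriv_from t\<^sub>0 h t + (\<delta> / t powr (q / 2)) *\<^sub>R h t
          + ((1 / \<gamma>) * t powr (q / 2)) *\<^sub>R deriv_from t\<^sub>0 F t + F t = 0"
    using \<open>strong_global_solution \<eta> A \<delta> \<gamma> q t\<^sub>0 x\<close>
    unfolding strong_global_solution_def Let_def h_def[symmetric] F_def[abs_def, symmetric] by blast+
  have ac_F: "locally_abs_continuous t\<^sub>0 F"
    unfolding locally_abs_continuous_def
  proof (intro allI impI)
    fix T assume "T > t\<^sub>0"
    with ac_x have "abs_continuous_on t\<^sub>0 T x" by (simp add: locally_abs_continuous_def)
    then show "abs_continuous_on t\<^sub>0 T F"
      unfolding F_def powr_minus_divide[symmetric] using \<open>t\<^sub>0 > 0\<close>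
      by (intro abs_continuous_on_add abs_continuous_on_scaleR abs_continuous_on_powr
          abs_continuous_on_lipschitz_compose[OF _ yosida_lipschitz])
  qed
  have monotone: "1 / t powr q * (norm (h t))\<^sup>2 - q / (t powr q * t) * (norm (x t) * norm (h t)) \<le> F' \<bullet> h t"
    if "t > t\<^sub>0" "(F has_vector_derivative F') (at t)" for t F'
  proof -
    have "t > 0" using that(1) \<open>t\<^sub>0 > 0\<close> by simp
    have x': "(x has_vector_derivative h t) (at t)"
      unfolding h_def using x_diff that(1) by (intro deriv_from_works) auto
    have e': "((\<lambda>t. 1 / t powr q) has_real_derivative - (q / (t powr q * t))) (at t)"
      using \<open>t > 0\<close> by (auto intro!: derivative_eq_intros simp: powr_diff power2_eq_square)
    \<comment> \<open>Subtracting the regularizing term shows that M(x(s)) is differentiable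
      wherever \<open>F\<close> is.\<close>
    have "((\<lambda>s. F s - (1 / s powr q) *\<^sub>R x s) has_vector_derivative
        F' - ((1 / t powr q) *\<^sub>R h t + (- (q / (t powr q * t))) *\<^sub>R x t)) (at t)"
      by (intro has_vector_derivative_diff that(2) has_vector_derivative_scaleR e' x')
    then have "((\<lambda>s. M (x s)) has_vector_derivative
        F' - ((1 / t powr q) *\<^sub>R h t + (- (q / (t powr q * t))) *\<^sub>R x t)) (at t)"
      by (simp add: F_def)
    from monotone_derivative_inner[OF x' this yosida_monotone]
    have "1 / t powr q * (norm (h t))\<^sup>2 - q / (t powr q * t) * (x t \<bullet> h t) \<le> F' \<bullet> h t"
      by (simp add: inner_diff_right inner_add_right inner_commute power2_norm_eq_inner)
    moreover have "q / (t powr q * t) * (x t \<bullet> h t) \<le> q / (t powr q * t) * (norm (x t) * norm (h t))"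
      using \<open>t > 0\<close> \<open>0 < q\<close> by (intro mult_left_mono norm_cauchy_schwarz) simp
    ultimately show ?thesis by linarith
  qed
  \<comment> \<open>The regularized operator takes the value p/t^q at the zero \<open>p\<close> of
    \<open>M\<close>, so strong monotonicity gives |x - p| \<le> t^q |F| + |p|; the second |p| comes
    from passing from x - p to x.\<close>
  have x_le: "norm (x t) \<le> t powr q * norm (F t) + 2 * norm p" if "t \<ge> t\<^sub>0" for t
  proof -
    have "t > 0" using that \<open>t\<^sub>0 > 0\<close> by simp
    have "1 / t powr q * norm (x t - p) \<le> norm (F t - (1 / t powr q) *\<^sub>R p)"
      using strong_monotone_bound[OF e_pos[OF \<open>t > 0\<close>], of "x t" p] by (simp add: F_def p)
    also have "\<dots> \<le> norm (F t) + norm ((1 / t powr q) *\<^sub>R p)" by (rule norm_triangle_ineq4)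
    also have "\<dots> = norm (F t) + 1 / t powr q * norm p" by simp
    finally have "norm (x t - p) \<le> t powr q * norm (F t) + norm p"
      using \<open>t > 0\<close> by (simp add: field_simps)
    then show ?thesis using norm_triangle_sub[of "x t" p] by simp
  qed
  have "AE t in lebesgue. t > t\<^sub>0 \<longrightarrow> (\<exists>F' h'.
        (F has_vector_derivative F') (at t) \<and> (h has_vector_derivative h') (at t) \<and>
        h' + (\<delta> / t powr (q / 2)) *\<^sub>R h t + ((1 / \<gamma>) * t powr (q / 2)) *\<^sub>R F' + F t = 0 \<and>
        1 / t powr q * (norm (h t))\<^sup>2 - q / (t powr q * t) * (norm (x t) * norm (h t)) \<le> F' \<bullet> h t)"
    by (rule eventually_mono[OF eqn]) (meson deriv_from_works less_imp_le monotone)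
  then obtain C where F_le: "eventually (\<lambda>t. (norm (F t))\<^sup>2 \<le> C * t powr (- q - 2)) at_top"
    and h_le: "eventually (\<lambda>t. (norm (h t))\<^sup>2 \<le> C * t powr (- 2)) at_top"
    using velocity_decay[OF \<open>\<gamma> > 0\<close> \<open>\<gamma> < \<delta>\<close> \<open>0 < q\<close> \<open>q < 1\<close> \<open>t\<^sub>0 > 0\<close> ac_F ac_h _ x_le] by blast
  have gap: "\<epsilon> t * norm (x t - x\<epsilon> t) \<le> norm (F t)"
    and residual: "M (x t) + \<epsilon> t *\<^sub>R x\<epsilon> t = F t - \<epsilon> t *\<^sub>R (x t - x\<epsilon> t)" if "t > 0" for t
  proof -
    show "\<epsilon> t * norm (x t - x\<epsilon> t) \<le> norm (F t)"
      using strong_monotone_bound[OF e_pos[OF that], of "x t" "x\<epsilon> t"] yosida_reg_zero[OF e_pos[OF that]]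
      by (simp add: F_def \<epsilon>_def x\<epsilon>_def)
    show "M (x t) + \<epsilon> t *\<^sub>R x\<epsilon> t = F t - \<epsilon> t *\<^sub>R (x t - x\<epsilon> t)"
      by (simp add: F_def \<epsilon>_def scaleR_diff_right)
  qed
  have rate_x: "eventually (\<lambda>t. 0 \<le> (norm (x t - x\<epsilon> t))\<^sup>2 \<and> (norm (x t - x\<epsilon> t))\<^sup>2 \<le> C * t powr (q - 2)) at_top"
    using F_le eventually_gt_at_top[of 0]
  proof eventually_elim
    case (elim t)
    have "norm (x t - x\<epsilon> t) \<le> t powr q * norm (F t)"
      using gap[OF elim(2)] elim(2) by (simp add: \<epsilon>_def field_simps)
    then have "(norm (x t - x\<epsilon> t))\<^sup>2 \<le> (t powr q * norm (F t))\<^sup>2" by (intro power_mono) auto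
    also have "\<dots> = t powr (2 * q) * (norm (F t))\<^sup>2"
      using elim(2) by (simp add: power_mult_distrib power2_eq_square flip: powr_add)
    also have "\<dots> \<le> t powr (2 * q) * (C * t powr (- q - 2))"
      using elim(1) by (intro mult_left_mono) auto
    also have "\<dots> = C * t powr (q - 2)"
      by (simp flip: powr_add)
    finally show ?case by simp
  qed
  have rate_h: "eventually (\<lambda>t. 0 \<le> (norm (h t))\<^sup>2 \<and> (norm (h t))\<^sup>2 \<le> C * t powr (- 2)) at_top"
    using h_le by simp
  have rate_M: "eventually (\<lambda>t. 0 \<le> (norm (M (x t) + \<epsilon> t *\<^sub>R x\<epsilon> t))\<^sup>2 \<and>
      (norm (M (x t) + \<epsilon> t *\<^sub>R x\<epsilon> t))\<^sup>2 \<le> (4 * C) * t powr (- q - 2)) at_top"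
    using F_le eventually_gt_at_top[of 0]
  proof eventually_elim
    case (elim t)
    have "norm (M (x t) + \<epsilon> t *\<^sub>R x\<epsilon> t) \<le> norm (F t) + norm (\<epsilon> t *\<^sub>R (x t - x\<epsilon> t))"
      unfolding residual[OF elim(2)] by (rule norm_triangle_ineq4)
    also have "\<dots> \<le> 2 * norm (F t)"
      using gap[OF elim(2)] e_pos[OF elim(2)] by (simp add: \<epsilon>_def)
    finally have "(norm (M (x t) + \<epsilon> t *\<^sub>R x\<epsilon> t))\<^sup>2 \<le> (2 * norm (F t))\<^sup>2"
      by (intro power_mono) auto
    then show ?case using elim(1) by (simp add: power_mult_distrib)
  qed
  \<comment> \<open>The same three rates serve both ranges of q: q - 2 is at most q/2 - 1 and 2q -
    2, while -2 and -q - 2 are at most -q/2 - 1 and q - 2.\<close>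
  show ?thesis
    unfolding h_def[symmetric]
    using \<open>0 < q\<close> \<open>q < 1\<close>
    by (intro conjI impI bigo_powrI[OF rate_x] bigo_powrI[OF rate_h] bigo_powrI[OF rate_M]) auto
qed

end
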